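(* Let $G=(V,E)$ be a loopless graph (multiple edges allowed), viewed as a hypergraph in which every hyperedge has two elements, and fix a ribbon structure, base node and base edge on $\mathrm{Bip}\,G$. Let $T$ be a $V$-cut Jaeger tree of $\mathrm{Bip}\,G$ and let $S$ be the set of edges of $T$ that are internally semi-passive with respect to the violet $T$-order of the edges of $\mathrm{Bip}\,G$. Then $S$ is a perfect matching between the set of internally inactive elements of $V$ for $\mathbf f_V(T)$ (with respect to the violet $T$-order on $V$) and the set of internally inactive elements of $E$ for $\mathbf f_E(T)$ (with respect to the violet $T$-order on $E$): every edge of $S$ joins two such inactive nodes, and every such inactive node is incident to exactly one edge of $S$.
   Context: $\mathrm{Bip}\,G$ is the bipartite graph with color classes $V$ (violet) and $E$ (emerald), each $e\in E$ joined to its two endpoints. A ribbon structure assigns to each node $x$ a cyclic permutation of its incident edges; $xy^+$ is the edge following $xy$ at $x$. Base node $b_0$, incident base edge $b_0b_1$. Tour of a spanning tree $T$ of $\mathrm{Bip}\,G$: pairs (current node, current edge) starting with $(b_0,b_0b_1)$; from $(x,xy)$ go to $(x,xy^+)$ if $xy\notin T$, to $(y,yx^+)$ if $xy\in T$; stop right before $(b_0,b_0b_1)$ recurs. Each edge $xy$ appears exactly twice; a non-edge $xy$ is cut at $x$ if $(x,xy)$ comes first. $T$ is a $V$-cut Jaeger tree if every non-edge of $T$ is cut at its violet endpoint. Violet $T$-order on edges: $ev<_{T,V}e'v'$ ($v,v'\in V$) iff $(v,ev)$ precedes $(v',e'v')$ in the tour. Violet $T$-order on $E$ (resp. $V$):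 $x_1<x_2$ iff some edge incident to $x_1$ precedes in the violet $T$-order every edge incident to $x_2$. For $\varepsilon\in T$, $C^*(T,\varepsilon)$ is the set of edges joining the two components of $T-\varepsilon$. Given a linear order on edges, $\varepsilon\in T$ is internally semi-passive if the smallest edge of $C^*(T,\varepsilon)$ has, in each component of $T-\varepsilon$, an endpoint of color different from the endpoint of $\varepsilon$ there. A hypertree on $E$ is $\mathbf f:E\to\mathbb Z_{\ge0}$ such that some spanning tree of $\mathrm{Bip}\,G$ has degree $\mathbf f(e)+1$ at each $e\in E$; similarly on $V$; $\mathbf f_E(T)(e)=d_T(e)-1$, $\mathbf f_V(T)(v)=d_T(v)-1$. Given a linear order on $X\in\{E,V\}$ and a hypertree $\mathbf f$ on $X$, $x\in X$ is internally inactive if there is $x'<x$ such that decreasing $\mathbf f$ by $1$ at $x$ and increasing by $1$ at $x'$ yields a hypertree on $X$. *)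

theory Defs
  imports Main "HOL-Combinatorics.Combinatorics"
begin

text \<open>
  A hypergraph is given by its vertices, its hyperedges and the set of vertices
  on each hyperedge; distinct hyperedges may have the same vertex set. A loopless
  graph is the case in which every hyperedge has exactly two elements.
\<close>

record ('v, 'e) hypergraph =
  hverts :: "'v set"
  hedges :: "'e set"
  hends  :: "'e \<Rightarrow> 'v set"

definition loopless_graph :: "('v, 'e) hypergraph \<Rightarrow> bool" where
  "loopless_graph G \<longleftrightarrow> finite (hverts G) \<and> finite (hedges G) \<and>
     (\<forall>e\<in>hedges G. hends G e \<subseteq> hverts G \<and> card (hends G e) = 2)"

datatype ('v, 'e) node = is_violet: Violet 'v | is_emerald: Emerald 'e

text \<open>
  The edges of \<open>Bip G\<close> are the incident pairs \<open>(e, v)\<close>; as \<open>Bip G\<close> has no parallel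
  edges, such a pair determines the edge. Subgraphs containing all nodes, in
  particular spanning trees, are identified with their edge sets.
\<close>

type_synonym ('v, 'e) bip_edge = "'e \<times> 'v"

definition violet_nodes :: "('v, 'e) hypergraph \<Rightarrow> ('v, 'e) node set" where
  "violet_nodes G = Violet ` hverts G"

definition emerald_nodes :: "('v, 'e) hypergraph \<Rightarrow> ('v, 'e) node set" where
  "emerald_nodes G = Emerald ` hedges G"

definition bip_nodes :: "('v, 'e) hypergraph \<Rightarrow> ('v, 'e) node set" where
  "bip_nodes G = violet_nodes G \<union> emerald_nodes G"

definition bip_edges :: "('v, 'e) hypergraph \<Rightarrow> ('v, 'e) bip_edge set" where
  "bip_edges G = {(e, v). e \<in> hedges G \<and> v \<in> hends G e}"

definition violet_end :: "('v, 'e) bip_edge \<Rightarrow> ('v, 'e) node" where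
  "violet_end \<epsilon> = Violet (snd \<epsilon>)"

definition emerald_end :: "('v, 'e) bip_edge \<Rightarrow> ('v, 'e) node" where
  "emerald_end \<epsilon> = Emerald (fst \<epsilon>)"

definition endpoints :: "('v, 'e) bip_edge \<Rightarrow> ('v, 'e) node set" where
  "endpoints \<epsilon> = {violet_end \<epsilon>, emerald_end \<epsilon>}"

definition opposite :: "('v, 'e) bip_edge \<Rightarrow> ('v, 'e) node \<Rightarrow> ('v, 'e) node" where
  "opposite \<epsilon> x = (if x = violet_end \<epsilon> then emerald_end \<epsilon> else violet_end \<epsilon>)"

definition incident :: "('v, 'e) bip_edge set \<Rightarrow> ('v, 'e) node \<Rightarrow> ('v, 'e) bip_edge set" where
  "incident F x = {\<epsilon> \<in> F. x \<in> endpoints \<epsilon>}"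

definition degree :: "('v, 'e) bip_edge set \<Rightarrow> ('v, 'e) node \<Rightarrow> nat" where
  "degree F x = card (incident F x)"


subsection \<open>Spanning trees\<close>

definition adjacent :: "('v, 'e) bip_edge set \<Rightarrow> (('v, 'e) node \<times> ('v, 'e) node) set" where
  "adjacent F = {(x, y). \<exists>\<epsilon>\<in>F. endpoints \<epsilon> = {x, y}}"

definition components :: "('v, 'e) hypergraph \<Rightarrow> ('v, 'e) bip_edge set \<Rightarrow> ('v, 'e) node set set" where
  "components G F = {{y \<in> bip_nodes G. (x, y) \<in> (adjacent F)\<^sup>*} | x. x \<in> bip_nodes G}"

definition is_cycle :: "('v, 'e) bip_edge set \<Rightarrow> ('v, 'e) node list \<Rightarrow> bool" where
  "is_cycle F xs \<longleftrightarrow> length xs \<ge> 3 \<and> distinct xs \<and>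
     (\<forall>i < length xs. (xs ! i, xs ! (Suc i mod length xs)) \<in> adjacent F)"

definition spanning_tree :: "('v, 'e) hypergraph \<Rightarrow> ('v, 'e) bip_edge set \<Rightarrow> bool" where
  "spanning_tree G T \<longleftrightarrow> T \<subseteq> bip_edges G \<and>
     (\<forall>x\<in>bip_nodes G. \<forall>y\<in>bip_nodes G. (x, y) \<in> (adjacent T)\<^sup>*) \<and>
     (\<nexists>xs. is_cycle T xs)"


subsection \<open>Ribbon structures, tours and Jaeger trees\<close>

text \<open>\<open>\<rho> x \<epsilon>\<close> is the edge following \<open>\<epsilon>\<close> at the node \<open>x\<close>.\<close>

type_synonym ('v, 'e) ribbon = "('v, 'e) node \<Rightarrow> ('v, 'e) bip_edge \<Rightarrow> ('v, 'e) bip_edge"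

definition ribbon_structure :: "('v, 'e) hypergraph \<Rightarrow> ('v, 'e) ribbon \<Rightarrow> bool" where
  "ribbon_structure G \<rho> \<longleftrightarrow> (\<forall>x\<in>bip_nodes G. incident (bip_edges G) x \<noteq> {} \<longrightarrow>
     \<rho> x permutes incident (bip_edges G) x \<and> cyclic_on (\<rho> x) (incident (bip_edges G) x))"

definition tour_step :: "('v, 'e) ribbon \<Rightarrow> ('v, 'e) bip_edge set \<Rightarrow>
    ('v, 'e) node \<times> ('v, 'e) bip_edge \<Rightarrow> ('v, 'e) node \<times> ('v, 'e) bip_edge" where
  "tour_step \<rho> T = (\<lambda>(x, \<epsilon>).
     if \<epsilon> \<in> T then (opposite \<epsilon> x, \<rho> (opposite \<epsilon> x) \<epsilon>) else (x, \<rho> x \<epsilon>))"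

text \<open>
  The pair \<open>s\<close> consists of the base node and the base edge. For a ribbon structure
  on a finite graph, \<open>tour_step \<rho> T\<close> permutes the finite set of incident node-edge
  pairs, so that \<open>s\<close> recurs and \<open>LEAST\<close> is meaningful.
\<close>

definition tour :: "('v, 'e) ribbon \<Rightarrow> ('v, 'e) node \<times> ('v, 'e) bip_edge \<Rightarrow>
    ('v, 'e) bip_edge set \<Rightarrow> (('v, 'e) node \<times> ('v, 'e) bip_edge) list" where
  "tour \<rho> s T = map (\<lambda>n. (tour_step \<rho> T ^^ n) s)
     [0..<(LEAST n. n > 0 \<and> (tour_step \<rho> T ^^ n) s = s)]"

definition precedes :: "'a list \<Rightarrow> 'a \<Rightarrow> 'a \<Rightarrow> bool" where
  "precedes xs p q \<longleftrightarrow> (\<exists>i j. i < j \<and> j < length xs \<and> xs ! i = p \<and> xs ! j = q)"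

definition V_cut_Jaeger_tree :: "('v, 'e) hypergraph \<Rightarrow> ('v, 'e) ribbon \<Rightarrow>
    ('v, 'e) node \<times> ('v, 'e) bip_edge \<Rightarrow> ('v, 'e) bip_edge set \<Rightarrow> bool" where
  "V_cut_Jaeger_tree G \<rho> s T \<longleftrightarrow> spanning_tree G T \<and>
     (\<forall>\<epsilon>\<in>bip_edges G - T. precedes (tour \<rho> s T) (violet_end \<epsilon>, \<epsilon>) (emerald_end \<epsilon>, \<epsilon>))"

definition violet_less :: "('v, 'e) ribbon \<Rightarrow> ('v, 'e) node \<times> ('v, 'e) bip_edge \<Rightarrow>
    ('v, 'e) bip_edge set \<Rightarrow> ('v, 'e) bip_edge \<Rightarrow> ('v, 'e) bip_edge \<Rightarrow> bool" where
  "violet_less \<rho> s T \<epsilon> \<epsilon>' \<longleftrightarrow> precedes (tour \<rho> s T) (violet_end \<epsilon>, \<epsilon>) (violet_end \<epsilon>', \<epsilon>')"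

definition violet_node_less :: "('v, 'e) hypergraph \<Rightarrow> ('v, 'e) ribbon \<Rightarrow>
    ('v, 'e) node \<times> ('v, 'e) bip_edge \<Rightarrow> ('v, 'e) bip_edge set \<Rightarrow>
    ('v, 'e) node \<Rightarrow> ('v, 'e) node \<Rightarrow> bool" where
  "violet_node_less G \<rho> s T x\<^sub>1 x\<^sub>2 \<longleftrightarrow> (\<exists>\<epsilon>\<in>incident (bip_edges G) x\<^sub>1.
     \<forall>\<epsilon>'\<in>incident (bip_edges G) x\<^sub>2. violet_less \<rho> s T \<epsilon> \<epsilon>')"


subsection \<open>Internal semi-passivity and internal inactivity\<close>

definition fundamental_cut :: "('v, 'e) hypergraph \<Rightarrow> ('v, 'e) bip_edge set \<Rightarrow>
    ('v, 'e) bip_edge \<Rightarrow> ('v, 'e) bip_edge set" where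
  "fundamental_cut G T \<epsilon> = {\<delta> \<in> bip_edges G. \<exists>K\<in>components G (T - {\<epsilon>}).
     \<exists>L\<in>components G (T - {\<epsilon>}). K \<noteq> L \<and> endpoints \<delta> \<inter> K \<noteq> {} \<and> endpoints \<delta> \<inter> L \<noteq> {}}"

definition internally_semi_passive :: "('v, 'e) hypergraph \<Rightarrow>
    (('v, 'e) bip_edge \<Rightarrow> ('v, 'e) bip_edge \<Rightarrow> bool) \<Rightarrow>
    ('v, 'e) bip_edge set \<Rightarrow> ('v, 'e) bip_edge \<Rightarrow> bool" where
  "internally_semi_passive G lt T \<epsilon> \<longleftrightarrow> \<epsilon> \<in> T \<and>
     (\<exists>\<delta>\<in>fundamental_cut G T \<epsilon>. (\<forall>\<delta>'\<in>fundamental_cut G T \<epsilon>. \<delta>' \<noteq> \<delta> \<longrightarrow> lt \<delta> \<delta>') \<and>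
       (\<forall>K\<in>components G (T - {\<epsilon>}). \<exists>x\<in>endpoints \<delta> \<inter> K. \<exists>y\<in>endpoints \<epsilon> \<inter> K.
          is_violet x \<noteq> is_violet y))"

text \<open>
  The colour class \<open>X\<close> is either \<open>violet_nodes G\<close> or \<open>emerald_nodes G\<close>; values of \<open>f\<close>
  outside \<open>X\<close> are irrelevant. Integer values let one form \<open>f x - 1\<close> when \<open>f x = 0\<close>,
  in which case the result is not a hypertree.
\<close>

definition hypertree :: "('v, 'e) hypergraph \<Rightarrow> ('v, 'e) node set \<Rightarrow>
    (('v, 'e) node \<Rightarrow> int) \<Rightarrow> bool" where
  "hypertree G X f \<longleftrightarrow> (\<forall>x\<in>X. f x \<ge> 0) \<and>
     (\<exists>T. spanning_tree G T \<and> (\<forall>x\<in>X. int (degree T x) = f x + 1))"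

definition hypertree_of :: "('v, 'e) bip_edge set \<Rightarrow> ('v, 'e) node \<Rightarrow> int" where
  "hypertree_of T x = int (degree T x) - 1"

definition internally_inactive :: "('v, 'e) hypergraph \<Rightarrow> ('v, 'e) node set \<Rightarrow>
    (('v, 'e) node \<Rightarrow> ('v, 'e) node \<Rightarrow> bool) \<Rightarrow> (('v, 'e) node \<Rightarrow> int) \<Rightarrow>
    ('v, 'e) node \<Rightarrow> bool" where
  "internally_inactive G X lt f x \<longleftrightarrow> x \<in> X \<and>
     (\<exists>x'\<in>X. lt x' x \<and> hypertree G X (f(x := f x - 1, x' := f x' + 1)))"

end

theory Submission
  imports Defs
begin

text \<open>
  For \<open>\<epsilon> \<in> T\<close> the tour first stays on the side of \<open>T - \<epsilon>\<close> containing the base node, crosses \<open>\<epsilon>\<close>,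
  visits the whole other side, crosses back, and stays on the base side. As non-edges are cut at
  their violet ends, this identifies the semi-passive edges: \<open>\<epsilon>\<close> is semi-passive iff its emerald end
  lies on the base side and some non-edge \<open>\<delta>\<close> has its violet end on the base side and its emerald
  end on the other one. Then \<open>T - \<epsilon> + \<delta>\<close> shows that both ends of \<open>\<epsilon>\<close> are inactive.
  Every violet node has only its parent edge as a candidate, and an emerald node has at most two
  tree edges, one of which is excluded by the tour. Conversely, if the parent edge of a violet node
  \<open>v\<close> admits no such \<open>\<delta>\<close>, then \<open>T\<close> already maximises, among spanning trees, the total degree of the
  violet nodes on the base side, so no degree can be moved there from \<open>v\<close>. For an emerald node \<open>e\<close>,
  a tree realising the exchanged hypertree crosses the cut at the node \<open>e'\<close> whose degree grew, and
  \<open>e' < e\<close> forces its new edge to be the required \<open>\<delta>\<close>.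
\<close>

section \<open>Reachability and forests\<close>

text \<open>The component of \<open>x\<close> in the graph with edge set \<open>F\<close>. No node
  set enters, so a node without incident edges in \<open>F\<close> forms its own component.\<close>

definition reach :: "('v, 'e) bip_edge set \<Rightarrow> ('v, 'e) node \<Rightarrow> ('v, 'e) node set" where
  "reach F x = (adjacent F)\<^sup>* `` {x}"

lemma ends_neq [simp]: "violet_end \<epsilon> \<noteq> emerald_end \<delta>" "emerald_end \<delta> \<noteq> violet_end \<epsilon>"
  by (auto simp: violet_end_def emerald_end_def)

lemma edge_eq_iff: "\<epsilon> = \<delta> \<longleftrightarrow> violet_end \<epsilon> = violet_end \<delta> \<and> emerald_end \<epsilon> = emerald_end \<delta>"
  by (auto simp: violet_end_def emerald_end_def prod_eq_iff)

lemma adjacent_iff: "(x, y) \<in> adjacent F \<longleftrightarrow>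
    (\<exists>\<epsilon>\<in>F. x = violet_end \<epsilon> \<and> y = emerald_end \<epsilon> \<or> x = emerald_end \<epsilon> \<and> y = violet_end \<epsilon>)"
  unfolding adjacent_def endpoints_def by (auto simp: doubleton_eq_iff)

lemma sym_adjacent: "sym (adjacent F)"
  by (auto simp: sym_def adjacent_iff)

lemma reach_refl [simp]: "x \<in> reach F x"
  by (simp add: reach_def)

lemma reach_sym: "y \<in> reach F x \<longleftrightarrow> x \<in> reach F y"
  using sym_rtrancl[OF sym_adjacent, of F] by (auto simp: reach_def sym_def)

lemma reach_trans: "y \<in> reach F x \<Longrightarrow> z \<in> reach F y \<Longrightarrow> z \<in> reach F x"
  by (auto simp: reach_def)

lemma reach_eq: "y \<in> reach F x \<Longrightarrow> reach F y = reach F x"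
  by (metis reach_sym reach_trans subsetI subset_antisym)

lemma reach_disjoint: "y \<notin> reach F x \<Longrightarrow> reach F x \<inter> reach F y = {}"
  by (metis disjoint_iff reach_sym reach_trans)

lemma reach_mono: "F \<subseteq> F' \<Longrightarrow> reach F x \<subseteq> reach F' x"
  unfolding reach_def by (intro Image_mono rtrancl_mono) (auto simp: adjacent_def)

lemma reach_ends: "\<epsilon> \<in> F \<Longrightarrow> emerald_end \<epsilon> \<in> reach F (violet_end \<epsilon>)"
  unfolding reach_def using adjacent_iff by blast

lemma violet_in_reach_iff: "\<epsilon> \<in> F \<Longrightarrow> violet_end \<epsilon> \<in> reach F x \<longleftrightarrow> emerald_end \<epsilon> \<in> reach F x"
  using reach_ends reach_sym reach_trans by metis

text \<open>A path cannot leave a set that no edge of \<open>F\<close> leaves. Later upper bounds on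
  components come from a suitable choice of \<open>U\<close>.\<close>

lemma reach_subsetI:
  assumes "x \<in> U" and "\<And>\<epsilon>. \<epsilon> \<in> F \<Longrightarrow> violet_end \<epsilon> \<in> U \<longleftrightarrow> emerald_end \<epsilon> \<in> U"
  shows "reach F x \<subseteq> U"
proof
  fix y assume "y \<in> reach F x"
  then have "(x, y) \<in> (adjacent F)\<^sup>*" by (simp add: reach_def)
  then show "y \<in> U"
    by induction (use assms in \<open>auto simp: adjacent_iff\<close>)
qed

text \<open>Both cases are closure arguments: the union of the two end components, and any component
  missing both ends, is closed under \<open>insert \<epsilon> F\<close>.\<close>

lemma reach_insert:
  "reach (insert \<epsilon> F) x =
    (if x \<in> reach F (violet_end \<epsilon>) \<union> reach F (emerald_end \<epsilon>)
     then reach F (violet_end \<epsilon>) \<union> reach F (emerald_end \<epsilon>) else reach F x)"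
proof (cases "x \<in> reach F (violet_end \<epsilon>) \<union> reach F (emerald_end \<epsilon>)")
  case True
  let ?U = "reach F (violet_end \<epsilon>) \<union> reach F (emerald_end \<epsilon>)"
  have "reach (insert \<epsilon> F) x \<subseteq> ?U"
    using True by (intro reach_subsetI) (auto simp: violet_in_reach_iff)
  moreover have "?U \<subseteq> reach (insert \<epsilon> F) (violet_end \<epsilon>)"
    using reach_mono[of F "insert \<epsilon> F"] reach_eq[OF reach_ends[of \<epsilon> "insert \<epsilon> F"]] by auto
  moreover have "reach (insert \<epsilon> F) x = reach (insert \<epsilon> F) (violet_end \<epsilon>)"
    using True calculation(2) by (intro reach_eq) auto
  ultimately show ?thesis
    using True by simp
next
  case False
  then have "violet_end \<epsilon> \<notin> reach F x" "emerald_end \<epsilon> \<notin> reach F x"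
    using reach_sym by blast+
  then have "reach (insert \<epsilon> F) x \<subseteq> reach F x"
    by (intro reach_subsetI) (auto simp: violet_in_reach_iff)
  then show ?thesis
    using False reach_mono[of F "insert \<epsilon> F" x] by auto
qed

text \<open>Acyclicity in the form that every edge is a bridge, which adapts to inserting and
  removing edges more easily than cycles given as node lists.\<close>

definition forest :: "('v, 'e) bip_edge set \<Rightarrow> bool" where
  "forest F \<longleftrightarrow> (\<forall>\<epsilon>\<in>F. emerald_end \<epsilon> \<notin> reach (F - {\<epsilon>}) (violet_end \<epsilon>))"

lemma forest_subset: "forest F \<Longrightarrow> F' \<subseteq> F \<Longrightarrow> forest F'"
  unfolding forest_def by (metis Diff_mono order_refl reach_mono subsetD)

lemma forest_insertD:
  "forest (insert \<epsilon> F) \<Longrightarrow> \<epsilon> \<notin> F \<Longrightarrow> emerald_end \<epsilon> \<notin> reach F (violet_end \<epsilon>)"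
  by (auto simp: forest_def)

section \<open>Cycles as node lists versus bridges\<close>

lemma rtrancl_distinct_path:
  assumes "(x, y) \<in> r\<^sup>*"
  shows "\<exists>xs. xs \<noteq> [] \<and> hd xs = x \<and> last xs = y \<and> distinct xs \<and> successively (\<lambda>a b. (a, b) \<in> r) xs"
  using assms
  proof (induction rule: rtrancl_induct)
    case base
    show ?case by (intro exI[of _ "[x]"]) auto
  next
    case (step y z)
    then obtain xs where xs: "xs \<noteq> []" "hd xs = x" "last xs = y" "distinct xs"
      "successively (\<lambda>a b. (a, b) \<in> r) xs" by blast
    show ?case
    proof (cases "z \<in> set xs")
      \<comment> \<open>A return to a node already on the path is answered by cutting the path
        there.\<close>
      case True
      then obtain ys zs where "xs = ys @ z # zs" by (auto simp: in_set_conv_decomp)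
      then show ?thesis
        using xs by (intro exI[of _ "ys @ [z]"]) (auto simp: hd_append successively_append_iff)
    next
      case False
      then show ?thesis
        using xs step.hyps by (intro exI[of _ "xs @ [z]"]) (auto simp: successively_append_iff)
    qed
  qed

text \<open>A simple path that joins the ends of \<open>\<epsilon>\<close> without using
  \<open>\<epsilon>\<close> becomes a cycle when \<open>\<epsilon>\<close> closes it.\<close>

lemma acyclic_imp_forest:
  assumes "\<nexists>xs. is_cycle F xs"
  shows "forest F"
  unfolding forest_def
proof (intro ballI notI)
  fix \<epsilon> assume \<epsilon>: "\<epsilon> \<in> F" and "emerald_end \<epsilon> \<in> reach (F - {\<epsilon>}) (violet_end \<epsilon>)"
  then have "(violet_end \<epsilon>, emerald_end \<epsilon>) \<in> (adjacent (F - {\<epsilon>}))\<^sup>*"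
    by (simp add: reach_def)
  from rtrancl_distinct_path[OF this] obtain xs where
    xs: "xs \<noteq> []" "hd xs = violet_end \<epsilon>" "last xs = emerald_end \<epsilon>" "distinct xs"
      "successively (\<lambda>a b. (a, b) \<in> adjacent (F - {\<epsilon>})) xs"
    by blast
  then have step: "\<And>i. Suc i < length xs \<Longrightarrow> (xs ! i, xs ! Suc i) \<in> adjacent (F - {\<epsilon>})"
    by (simp add: successively_conv_nth)
  have hd_last: "xs ! 0 = violet_end \<epsilon>" "xs ! (length xs - 1) = emerald_end \<epsilon>"
    using xs by (auto simp: hd_conv_nth last_conv_nth)
  have "length xs \<noteq> 1" "length xs \<noteq> 0"
    using hd_last xs by auto
  \<comment> \<open>A path of one edge would be an edge parallel to \<open>\<epsilon>\<close>, but
    an edge is determined by its ends.\<close>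
  moreover have "length xs \<noteq> 2"
  proof
    assume "length xs = 2"
    then have "(violet_end \<epsilon>, emerald_end \<epsilon>) \<in> adjacent (F - {\<epsilon>})"
      using step[of 0] hd_last by simp
    then show False by (auto simp: adjacent_iff edge_eq_iff)
  qed
  ultimately have "length xs \<ge> 3" by linarith
  moreover have "(xs ! i, xs ! (Suc i mod length xs)) \<in> adjacent F" if "i < length xs" for i
  proof (cases "Suc i < length xs")
    case True
    then show ?thesis using step[of i] by (auto simp: adjacent_iff)
  next
    case False
    then have "i = length xs - 1" "Suc i mod length xs = 0"
      using that by (auto simp: less_Suc_eq not_less_eq)
    then show ?thesis using hd_last \<epsilon> by (auto simp: adjacent_iff)
  qed
  ultimately have "is_cycle F xs"
    using xs(4) by (simp add: is_cycle_def)
  then show False using assms by blast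
qed

text \<open>A cycle destroyed by removing \<open>\<delta>\<close> passes through
  \<open>\<delta>\<close>, and the rest of it is a path in \<open>F\<close> between the ends of
  \<open>\<delta>\<close>.\<close>

lemma is_cycle_removed_edge:
  assumes cyc: "is_cycle (insert \<delta> F) xs" and nocyc: "\<not> is_cycle F xs"
  shows "emerald_end \<delta> \<in> reach F (violet_end \<delta>)"
proof -
  let ?n = "length xs"
  from cyc have n: "?n \<ge> 3" and dist: "distinct xs"
    and adj: "\<And>i. i < ?n \<Longrightarrow> (xs ! i, xs ! (Suc i mod ?n)) \<in> adjacent (insert \<delta> F)"
    by (auto simp: is_cycle_def)
  obtain i where i: "i < ?n" "(xs ! i, xs ! (Suc i mod ?n)) \<notin> adjacent F"
    using nocyc n dist by (auto simp: is_cycle_def)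
  \<comment> \<open>The rotation makes \<open>\<delta>\<close> the closing step, from the last node
    to the first.\<close>
  define ys where "ys = rotate (Suc i) xs"
  have ys: "length ys = ?n" "distinct ys"
    using dist by (auto simp: ys_def)
  have nth_ys: "ys ! j = xs ! ((Suc i + j) mod ?n)" if "j < ?n" for j
    using nth_rotate[OF that, of "Suc i"] by (simp add: ys_def)
  have ysadj: "(ys ! j, ys ! Suc j) \<in> adjacent (insert \<delta> F)" if "Suc j < ?n" for j
  proof -
    have "(Suc i + j) mod ?n < ?n" using that by (intro mod_less_divisor) auto
    from adj[OF this] show ?thesis using that by (simp add: nth_ys mod_Suc_eq)
  qed
  have last: "ys ! (?n - 1) = xs ! i"
  proof -
    have "Suc i + (?n - 1) = i + ?n" using n by simp
    then show ?thesis using n i(1) nth_ys[of "?n - 1"] by simp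
  qed
  have hd: "ys ! 0 = xs ! (Suc i mod ?n)"
    using n by (subst nth_ys) auto
  have \<delta>: "endpoints \<delta> = {ys ! (?n - 1), ys ! 0}"
    using adj[OF i(1)] i(2) unfolding last hd by (auto simp: adjacent_iff endpoints_def)
  have "(ys ! 0, ys ! j) \<in> (adjacent F)\<^sup>*" if "j < ?n" for j
    using that
  proof (induction j)
    case (Suc j)
    \<comment> \<open>As the nodes are distinct, a second use of \<open>\<delta>\<close> would have
      to lead from the first node to the last, forcing length two.\<close>
    have "endpoints \<delta> \<noteq> {ys ! j, ys ! Suc j}"
    proof
      assume "endpoints \<delta> = {ys ! j, ys ! Suc j}"
      then have "ys ! j = ys ! (?n - 1) \<or> ys ! j = ys ! 0 \<and> ys ! Suc j = ys ! (?n - 1)"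
        unfolding \<delta> by (auto simp: doubleton_eq_iff)
      moreover have "j < ?n" "?n - 1 < ?n" "0 < ?n" using Suc.prems by auto
      ultimately have "j = ?n - 1 \<or> j = 0 \<and> Suc j = ?n - 1"
        using Suc.prems ys by (simp add: nth_eq_iff_index_eq)
      then show False using n Suc.prems by auto
    qed
    then have "(ys ! j, ys ! Suc j) \<in> adjacent F"
      using ysadj[OF Suc.prems] by (auto simp: adjacent_iff endpoints_def)
    then show ?case using Suc by auto
  qed simp
  from this[of "?n - 1"] have "ys ! (?n - 1) \<in> reach F (ys ! 0)"
    using n by (auto simp: reach_def)
  then show ?thesis
    using \<delta> reach_sym unfolding endpoints_def by (metis doubleton_eq_iff)
qed

section \<open>Spanning trees and forests: exchange and counting\<close>

lemma spanning_tree_forest: "spanning_tree G T \<Longrightarrow> forest T"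
  by (auto simp: spanning_tree_def intro: acyclic_imp_forest)

text \<open>The ends of \<open>\<delta>\<close> lie in different components of
  \<open>T - {\<epsilon>}\<close>, so \<open>\<delta>\<close> closes no cycle, and it connects the
  ends of \<open>\<epsilon>\<close> again. The crossed position of the colours is the one that
  semi-passive edges lead to.\<close>

lemma spanning_tree_exchange:
  assumes "spanning_tree G T" "\<epsilon> \<in> T" "\<delta> \<in> bip_edges G"
    and ends: "violet_end \<delta> \<in> reach (T - {\<epsilon>}) (emerald_end \<epsilon>)"
      "emerald_end \<delta> \<in> reach (T - {\<epsilon>}) (violet_end \<epsilon>)"
  shows "spanning_tree G (insert \<delta> (T - {\<epsilon>}))"
proof -
  let ?F = "T - {\<epsilon>}"
  have "emerald_end \<epsilon> \<notin> reach ?F (violet_end \<epsilon>)"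
    using spanning_tree_forest[OF assms(1)] assms(2) by (auto simp: forest_def)
  with ends have "emerald_end \<delta> \<notin> reach ?F (violet_end \<delta>)"
    using reach_sym reach_trans by metis
  moreover have "\<not> is_cycle ?F xs" for xs
  proof
    assume "is_cycle ?F xs"
    moreover have "adjacent ?F \<subseteq> adjacent T" by (auto simp: adjacent_def)
    ultimately have "is_cycle T xs"
      by (auto simp: is_cycle_def)
    then show False using assms(1) by (auto simp: spanning_tree_def)
  qed
  ultimately have "\<nexists>xs. is_cycle (insert \<delta> ?F) xs"
    using is_cycle_removed_edge by blast
  moreover have "reach T x \<subseteq> reach (insert \<delta> ?F) x" for x
  proof (rule reach_subsetI)
    fix \<eta> assume "\<eta> \<in> T"
    have "emerald_end \<epsilon> \<in> reach (insert \<delta> ?F) (violet_end \<epsilon>)"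
      using ends reach_sym[of _ ?F] by (auto simp: reach_insert)
    then have "violet_end \<epsilon> \<in> reach (insert \<delta> ?F) x \<longleftrightarrow> emerald_end \<epsilon> \<in> reach (insert \<delta> ?F) x"
      using reach_sym reach_trans by metis
    then show "violet_end \<eta> \<in> reach (insert \<delta> ?F) x \<longleftrightarrow> emerald_end \<eta> \<in> reach (insert \<delta> ?F) x"
      using \<open>\<eta> \<in> T\<close> violet_in_reach_iff[of \<eta> "insert \<delta> ?F"] by (cases "\<eta> = \<epsilon>") auto
  qed auto
  ultimately show ?thesis
    using assms(1,3) unfolding spanning_tree_def reach_def by fast
qed

text \<open>Each edge added to a forest unites two different components, so the number of components
  within \<open>N\<close> drops by one as the number of edges grows by one.\<close>

lemma forest_card:
  fixes F :: "('v, 'e) bip_edge set"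
  assumes "finite F" "finite N" "forest F" "\<And>\<epsilon>. \<epsilon> \<in> F \<Longrightarrow> endpoints \<epsilon> \<subseteq> N"
  shows "card F + card (reach F ` N) = card N"
  using assms(1,3,4)
proof (induction F)
  case empty
  have "reach {} x = {x}" for x :: "('v, 'e) node"
    using reach_subsetI[of x "{x}" "{}"] by auto
  then show ?case
    by (simp add: card_image inj_on_def)
next
  case (insert \<epsilon> F)
  let ?A = "reach F (violet_end \<epsilon>)" and ?B = "reach F (emerald_end \<epsilon>)"
  let ?C = "reach F ` N"
  have ends: "violet_end \<epsilon> \<in> N" "emerald_end \<epsilon> \<in> N"
    using insert.prems(2)[of \<epsilon>] by (auto simp: endpoints_def)
  have nin: "emerald_end \<epsilon> \<notin> ?A"
    using insert.prems(1) insert.hyps(2) by (rule forest_insertD)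
  then have "?A \<noteq> ?B" by (metis reach_refl)
  have "reach (insert \<epsilon> F) ` N = insert (?A \<union> ?B) (?C - {?A, ?B})"
  proof (intro equalityI subsetI)
    fix Z assume "Z \<in> reach (insert \<epsilon> F) ` N"
    then obtain x where x: "x \<in> N" "Z = reach (insert \<epsilon> F) x" by auto
    show "Z \<in> insert (?A \<union> ?B) (?C - {?A, ?B})"
    proof (cases "x \<in> ?A \<union> ?B")
      case True
      then show ?thesis by (simp add: x(2) reach_insert)
    next
      case False
      then have "reach F x \<noteq> ?A" "reach F x \<noteq> ?B" using reach_refl[of x F] by (metis UnI1, metis UnI2)
      then show ?thesis using x(1) False by (simp add: x(2) reach_insert)
    qed
  next
    fix Z assume Z: "Z \<in> insert (?A \<union> ?B) (?C - {?A, ?B})"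
    then consider "Z = ?A \<union> ?B" | x where "x \<in> N" "Z = reach F x" "reach F x \<noteq> ?A" "reach F x \<noteq> ?B"
      by auto
    then show "Z \<in> reach (insert \<epsilon> F) ` N"
    proof cases
      case 1
      then have "Z = reach (insert \<epsilon> F) (violet_end \<epsilon>)" by (simp add: reach_insert)
      then show ?thesis using ends by blast
    next
      case 2
      then have "x \<notin> ?A \<union> ?B" using reach_eq by blast
      then have "Z = reach (insert \<epsilon> F) x" by (simp add: reach_insert 2)
      then show ?thesis using 2 by blast
    qed
  qed
  \<comment> \<open>A component equal to the union would contain the violet end and hence be
    \<open>?A\<close>, which has been taken out.\<close>
  moreover have "?A \<union> ?B \<notin> ?C - {?A, ?B}"
  proof
    assume "?A \<union> ?B \<in> ?C - {?A, ?B}"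
    then obtain x where "reach F x = ?A \<union> ?B" "reach F x \<noteq> ?A" by auto
    moreover from this have "violet_end \<epsilon> \<in> reach F x" by auto
    ultimately show False using reach_eq by metis
  qed
  moreover have "card (?C - {?A, ?B}) + 2 = card ?C"
  proof -
    have "{?A, ?B} \<subseteq> ?C" using ends by auto
    moreover have "card {?A, ?B} = 2" using \<open>?A \<noteq> ?B\<close> by simp
    ultimately show ?thesis
      using assms(2) by (metis card_Diff_subset card_mono finite.emptyI finite_imageI finite_insert
          le_add_diff_inverse2)
  qed
  moreover have "finite ?C" using assms(2) by simp
  moreover have "card F + card ?C = card N"
    using insert by (intro insert.IH) (auto intro: forest_subset)
  ultimately show ?case
    using insert.hyps by simp
qed

text \<open>After removal of \<open>\<epsilon>\<close> the component of \<open>y\<close> misses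
  \<open>x\<close>, so its paths do not use \<open>\<zeta>\<close>. It survives the removal of
  \<open>\<zeta>\<close> instead, and there \<open>\<epsilon>\<close> attaches it to
  \<open>x\<close>.\<close>

lemma reach_remove_adjacent_edge:
  assumes "forest F" "\<epsilon> \<in> F" "\<epsilon> \<noteq> \<zeta>" "endpoints \<epsilon> = {x, y}" "x \<in> endpoints \<zeta>"
  shows "reach (F - {\<epsilon>}) y \<subseteq> reach (F - {\<zeta>}) x"
proof -
  have "x \<notin> reach (F - {\<epsilon>}) y"
    using assms(1,2,4) reach_sym by (fastforce simp: forest_def endpoints_def doubleton_eq_iff)
  have "reach (F - {\<epsilon>}) y \<subseteq> reach (F - {\<epsilon>}) y \<inter> reach (F - {\<epsilon>, \<zeta>}) y"
  proof (rule reach_subsetI)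
    fix \<eta> assume \<eta>: "\<eta> \<in> F - {\<epsilon>}"
    show "violet_end \<eta> \<in> reach (F - {\<epsilon>}) y \<inter> reach (F - {\<epsilon>, \<zeta>}) y \<longleftrightarrow>
        emerald_end \<eta> \<in> reach (F - {\<epsilon>}) y \<inter> reach (F - {\<epsilon>, \<zeta>}) y"
    proof (cases "\<eta> = \<zeta>")
      case True
      have "z \<notin> reach (F - {\<epsilon>}) y" if "z \<in> endpoints \<zeta>" for z
        using that assms(5) \<open>x \<notin> _\<close> violet_in_reach_iff[OF \<eta>, of y] True
        by (auto simp: endpoints_def)
      then show ?thesis unfolding True by (auto simp: endpoints_def)
    next
      case False
      then show ?thesis
        using \<eta> violet_in_reach_iff[of \<eta> "F - {\<epsilon>}" y] violet_in_reach_iff[of \<eta> "F - {\<epsilon>, \<zeta>}" y]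
        by auto
    qed
  qed auto
  also have "\<dots> \<subseteq> reach (F - {\<zeta>}) y"
    using reach_mono[of "F - {\<epsilon>, \<zeta>}" "F - {\<zeta>}" y] by auto
  also have "\<dots> = reach (F - {\<zeta>}) x"
  proof -
    have "y \<in> reach (F - {\<zeta>}) x"
      using assms(2-4) reach_ends[of \<epsilon> "F - {\<zeta>}"] reach_sym
      by (fastforce simp: endpoints_def doubleton_eq_iff)
    then show ?thesis by (rule reach_eq)
  qed
  finally show ?thesis .
qed

text \<open>Without \<open>\<zeta>\<close> the only edge left at \<open>x\<close> is
  \<open>\<epsilon>\<close>, so all of the component except \<open>x\<close> lies behind
  \<open>\<epsilon>\<close>.\<close>

lemma reach_remove_at_degree_two:
  assumes "forest F" "incident F x = {\<epsilon>, \<zeta>}" "\<epsilon> \<noteq> \<zeta>" "endpoints \<epsilon> = {x, y}"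
  shows "reach (F - {\<zeta>}) x = insert x (reach (F - {\<epsilon>}) y)"
proof
  have mem: "\<epsilon> \<in> F" "\<zeta> \<in> F" "x \<in> endpoints \<zeta>" using assms(2) by (auto simp: incident_def)
  show "insert x (reach (F - {\<epsilon>}) y) \<subseteq> reach (F - {\<zeta>}) x"
    using reach_remove_adjacent_edge[OF assms(1) mem(1) assms(3,4) mem(3)] by auto
  show "reach (F - {\<zeta>}) x \<subseteq> insert x (reach (F - {\<epsilon>}) y)"
  proof (rule reach_subsetI)
    fix \<eta> assume \<eta>: "\<eta> \<in> F - {\<zeta>}"
    show "violet_end \<eta> \<in> insert x (reach (F - {\<epsilon>}) y) \<longleftrightarrow>
        emerald_end \<eta> \<in> insert x (reach (F - {\<epsilon>}) y)"
    proof (cases "\<eta> = \<epsilon>")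
      case True
      then show ?thesis using assms(4) by (auto simp: endpoints_def doubleton_eq_iff)
    next
      case False
      then have "x \<notin> endpoints \<eta>" using \<eta> assms(2) by (auto simp: incident_def)
      then show ?thesis
        using False \<eta> violet_in_reach_iff[of \<eta> "F - {\<epsilon>}" y] by (auto simp: endpoints_def)
    qed
  qed auto
qed

text \<open>The edge found here is the one joining \<open>x\<close> to its parent when \<open>F\<close> is rooted at \<open>r\<close>.\<close>

lemma parent_edge_exists:
  assumes "r \<in> reach F x" "r \<noteq> x"
  shows "\<exists>\<epsilon>\<in>F. \<exists>y. endpoints \<epsilon> = {x, y} \<and> r \<in> reach (F - {\<epsilon>}) y"
proof (rule ccontr)
  assume "\<not> ?thesis"
  then have none: "r \<notin> reach (F - {\<epsilon>}) y" if "\<epsilon> \<in> F" "endpoints \<epsilon> = {x, y}" for \<epsilon> y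
    using that by blast
  let ?F = "{\<epsilon> \<in> F. x \<notin> endpoints \<epsilon>}"
  have off: "reach ?F r \<subseteq> - {x}"
    using assms(2) by (intro reach_subsetI) (auto simp: endpoints_def)
  have sub: "reach ?F z \<subseteq> reach (F - {\<epsilon>}) z" if "x \<in> endpoints \<epsilon>" for \<epsilon> z
    using that by (intro reach_mono) auto
  have "reach F r \<subseteq> reach ?F r"
  proof (rule reach_subsetI)
    fix \<eta> assume \<eta>: "\<eta> \<in> F"
    show "violet_end \<eta> \<in> reach ?F r \<longleftrightarrow> emerald_end \<eta> \<in> reach ?F r"
    proof (cases "x \<in> endpoints \<eta>")
      case False
      then show ?thesis using \<eta> by (intro violet_in_reach_iff) auto
    next
      case True
      then obtain y where y: "endpoints \<eta> = {x, y}"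
        by (auto simp: endpoints_def)
      have "y \<notin> reach ?F r"
        using none[OF \<eta> y] sub[OF True, of y] reach_sym by auto
      moreover have "x \<notin> reach ?F r" using off by auto
      ultimately show ?thesis using y by (auto simp: endpoints_def doubleton_eq_iff)
    qed
  qed auto
  then show False using assms(1) off reach_sym by auto
qed

section \<open>Tours of forests\<close>

text \<open>Applying \<open>f\<close> entrywise shifts the list cyclically by one, so
  \<open>xs\<close> enumerates one cycle of \<open>f\<close> in order. With lists, merging cycles
  becomes concatenation.\<close>

definition lists_cycle :: "('a \<Rightarrow> 'a) \<Rightarrow> 'a list \<Rightarrow> bool" where
  "lists_cycle f xs \<longleftrightarrow> xs \<noteq> [] \<and> distinct xs \<and> map f xs = rotate1 xs"

lemma lists_cycle_cong:
  "(\<And>x. x \<in> set xs \<Longrightarrow> f x = g x) \<Longrightarrow> lists_cycle f xs \<longleftrightarrow> lists_cycle g xs"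
  by (simp add: lists_cycle_def cong: map_cong)

lemma lists_cycle_append_commute:
  assumes "lists_cycle f (xs @ ys)"
  shows "lists_cycle f (ys @ xs)"
proof -
  have "ys @ xs = rotate (length xs) (xs @ ys)" by (simp add: rotate_append)
  then show ?thesis
    using assms by (simp add: lists_cycle_def rotate_map[symmetric] rotate1_rotate_swap del: rotate_append)
qed

lemma lists_cycle_ending_with:
  assumes "lists_cycle f xs" "a \<in> set xs"
  shows "\<exists>as. lists_cycle f (as @ [a]) \<and> set (as @ [a]) = set xs"
proof -
  obtain us ws where xs: "xs = (us @ [a]) @ ws"
    using assms(2) by (auto simp: in_set_conv_decomp)
  then have "lists_cycle f ((ws @ us) @ [a])"
    using lists_cycle_append_commute[of f "us @ [a]" ws] assms(1) by simp
  then show ?thesis using xs by (intro exI[of _ "ws @ us"]) auto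
qed

text \<open>Swapping the images of two points on disjoint cycles fuses the cycles. Ending the lists
  at these points turns the fusion into concatenation.\<close>

lemma lists_cycle_merge:
  assumes "lists_cycle f (as @ [a])" "lists_cycle f (bs @ [b])"
    and "set (as @ [a]) \<inter> set (bs @ [b]) = {}"
    and "g a = f b" "g b = f a" "\<And>x. x \<in> set as \<union> set bs \<Longrightarrow> g x = f x"
  shows "lists_cycle g (as @ a # bs @ [b])"
proof -
  have "map f as = tl (as @ [a])" "f a = hd (as @ [a])"
    "map f bs = tl (bs @ [b])" "f b = hd (bs @ [b])"
    using assms(1,2) by (auto simp: lists_cycle_def rotate1_hd_tl)
  moreover have "map g as = map f as" "map g bs = map f bs"
    using assms(6) by auto
  ultimately have "map g (as @ a # bs @ [b]) = rotate1 (as @ a # bs @ [b])"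
    using assms(4,5) by (cases as; cases bs) (auto simp: rotate1_hd_tl)
  then show ?thesis
    using assms(1-3) by (auto simp: lists_cycle_def)
qed

lemma lists_cycle_funpow:
  assumes "lists_cycle f xs"
  shows "map (f ^^ n) xs = rotate n xs"
proof (induction n)
  case (Suc n)
  have "map (f ^^ Suc n) xs = map f (map (f ^^ n) xs)" by simp
  also have "\<dots> = rotate n (map f xs)" using Suc by (simp add: rotate_map)
  also have "\<dots> = rotate (Suc n) xs"
    using assms by (simp add: lists_cycle_def rotate1_rotate_swap)
  finally show ?case .
qed simp

text \<open>The iterates of the head run through the list periodically, so the first return time in
  the definition of \<open>tour\<close> is the length of the list.\<close>

lemma tour_eqI:
  assumes "lists_cycle (tour_step \<rho> T) xs" "hd xs = s"
  shows "tour \<rho> s T = xs"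
proof -
  let ?f = "tour_step \<rho> T"
  have xs: "xs \<noteq> []" "distinct xs" using assms by (auto simp: lists_cycle_def)
  have pow: "(?f ^^ n) s = xs ! (n mod length xs)" for n
  proof -
    have "(?f ^^ n) s = hd (map (?f ^^ n) xs)"
      using xs assms(2) by (simp add: hd_map)
    then show ?thesis
      using lists_cycle_funpow[OF assms(1)] xs by (simp add: hd_rotate_conv_nth)
  qed
  have s: "s = xs ! 0" using assms(2) xs by (simp add: hd_conv_nth)
  have "(LEAST n. n > 0 \<and> (?f ^^ n) s = s) = length xs"
  proof (rule Least_equality)
    show "length xs > 0 \<and> (?f ^^ length xs) s = s"
      using xs pow[of "length xs"] s by simp
  next
    fix n assume n: "n > 0 \<and> (?f ^^ n) s = s"
    then have "xs ! (n mod length xs) = xs ! 0" using s pow[of n] by simp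
    then have "n mod length xs = 0"
      using xs by (subst (asm) nth_eq_iff_index_eq) auto
    then show "length xs \<le> n" using n by (auto intro: dvd_imp_le)
  qed
  then show ?thesis
    unfolding tour_def by (intro nth_equalityI) (auto simp: pow)
qed

lemma cyclic_on_imp_lists_cycle:
  assumes "cyclic_on f S"
  shows "\<exists>xs. lists_cycle f xs \<and> set xs = S"
proof -
  from assms obtain s where s: "s \<in> S" "S = orbit f s"
    by (auto simp: cyclic_on_def)
  then have self: "s \<in> orbit f s" by simp
  \<comment> \<open>Off by one: \<open>n\<close> is the distance from \<open>f s\<close> to
    \<open>s\<close>, so the first return time of \<open>s\<close> is \<open>Suc n\<close>.\<close>
  define n where "n = funpow_dist f (f s) s"
  let ?xs = "map (\<lambda>i. (f ^^ i) s) [0..<Suc n]"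
  have ret: "(f ^^ Suc n) s = s"
    using funpow_dist1_prop[OF self] by (simp add: n_def)
  have "distinct ?xs"
    using inj_on_funpow_dist1[OF self] by (simp add: distinct_map n_def atLeast0LessThan del: upt_Suc)
  moreover have "map f ?xs = rotate1 ?xs"
  proof -
    have "map f ?xs = map (\<lambda>i. (f ^^ i) s) (map Suc [0..<Suc n])" by simp
    also have "\<dots> = map (\<lambda>i. (f ^^ i) s) ([Suc 0..<Suc n] @ [Suc n])"
      by (subst map_Suc_upt) simp
    also have "\<dots> = rotate1 ?xs"
      using ret by (simp add: upt_conv_Cons del: upt_Suc)
    finally show ?thesis .
  qed
  moreover have "set ?xs = S"
    using orbit_altdef_bounded[OF ret] s(2) by (auto simp del: upt_Suc simp: atLeast0LessThan)
  ultimately show ?thesis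
    by (intro exI[of _ ?xs]) (auto simp: lists_cycle_def)
qed

section \<open>Orbits of the tour step on node-edge pairs\<close>

definition darts :: "('v, 'e) bip_edge set \<Rightarrow> ('v, 'e) node set \<Rightarrow> (('v, 'e) node \<times> ('v, 'e) bip_edge) set" where
  "darts F K = {(x, \<epsilon>). x \<in> K \<and> \<epsilon> \<in> incident F x}"

lemma ends_in_bip_nodes:
  assumes "loopless_graph G" "\<epsilon> \<in> bip_edges G"
  shows "violet_end \<epsilon> \<in> bip_nodes G" "emerald_end \<epsilon> \<in> bip_nodes G"
  using assms by (fastforce simp: loopless_graph_def bip_edges_def violet_end_def emerald_end_def
      bip_nodes_def violet_nodes_def emerald_nodes_def)+

lemma finite_bip_edges: "loopless_graph G \<Longrightarrow> finite (bip_edges G)"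
  by (rule finite_subset[of _ "hedges G \<times> hverts G"])
    (auto simp: loopless_graph_def bip_edges_def)

lemma opposite_eq: "endpoints \<epsilon> = {x, y} \<Longrightarrow> opposite \<epsilon> x = y"
  by (auto simp: endpoints_def opposite_def doubleton_eq_iff)

text \<open>Adding \<open>\<epsilon>\<close> to \<open>F\<close> precomposes the tour step with the transposition of the two darts of
  \<open>\<epsilon>\<close>; as these lie on different cycles, the cycles merge.\<close>

lemma lists_cycle_insert_edge:
  assumes "\<epsilon> \<notin> F" "endpoints \<epsilon> = {x, y}" "y \<notin> reach F x"
    and "lists_cycle (tour_step \<rho> F) (as @ [(x, \<epsilon>)])"
      "set (as @ [(x, \<epsilon>)]) = darts E (reach F x)"
    and "lists_cycle (tour_step \<rho> F) (bs @ [(y, \<epsilon>)])"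
      "set (bs @ [(y, \<epsilon>)]) = darts E (reach F y)"
  shows "lists_cycle (tour_step \<rho> (insert \<epsilon> F)) (as @ (x, \<epsilon>) # bs @ [(y, \<epsilon>)])"
proof (rule lists_cycle_merge[OF assms(4,6)])
  show "set (as @ [(x, \<epsilon>)]) \<inter> set (bs @ [(y, \<epsilon>)]) = {}"
    using reach_disjoint[OF assms(3)] unfolding assms(5,7) by (auto simp: darts_def)
  have "opposite \<epsilon> x = y" "opposite \<epsilon> y = x"
    using assms(2) by (auto intro!: opposite_eq simp: insert_commute)
  then show "tour_step \<rho> (insert \<epsilon> F) (x, \<epsilon>) = tour_step \<rho> F (y, \<epsilon>)"
    "tour_step \<rho> (insert \<epsilon> F) (y, \<epsilon>) = tour_step \<rho> F (x, \<epsilon>)"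
    using assms(1) by (auto simp: tour_step_def)
next
  fix d assume d: "d \<in> set as \<union> set bs"
  obtain z \<eta> where z: "d = (z, \<eta>)" by (cases d)
  have "d \<in> darts E (reach F x) \<union> darts E (reach F y)"
    using d assms(5,7) by auto
  then have "z \<in> endpoints \<eta>" by (auto simp: z darts_def incident_def)
  moreover have "d \<noteq> (x, \<epsilon>)" "d \<noteq> (y, \<epsilon>)"
    using d assms(4,6) arg_cong[OF assms(5), of "\<lambda>A. d \<in> A"] arg_cong[OF assms(7), of "\<lambda>A. d \<in> A"]
      assms(3) reach_disjoint[OF assms(3)]
    by (auto simp: lists_cycle_def darts_def)
  ultimately have "\<eta> \<noteq> \<epsilon>" using assms(2) z by auto
  then show "tour_step \<rho> (insert \<epsilon> F) d = tour_step \<rho> F d"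
    by (simp add: tour_step_def z)
qed

text \<open>Induction on the edges of the forest. With no edges, the tour step rotates about a
  single node; each further edge merges the cycles of the two components that it joins. So every
  component carries exactly one cycle.\<close>

lemma forest_orbit:
  assumes G: "loopless_graph G" "ribbon_structure G \<rho>"
    and F: "forest F" "F \<subseteq> bip_edges G"
    and x: "x \<in> bip_nodes G" "incident (bip_edges G) x \<noteq> {}"
  shows "\<exists>xs. lists_cycle (tour_step \<rho> F) xs \<and> set xs = darts (bip_edges G) (reach F x)"
proof -
  let ?E = "bip_edges G"
  have "finite F" using finite_bip_edges[OF G(1)] F(2) by (rule rev_finite_subset)
  then show ?thesis using F x
  proof (induction F arbitrary: x)
    case empty
    have "cyclic_on (\<rho> x) (incident ?E x)"
      using G(2) empty.prems by (simp add: ribbon_structure_def)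
    from cyclic_on_imp_lists_cycle[OF this] obtain xs
      where xs: "lists_cycle (\<rho> x) xs" "set xs = incident ?E x" by blast
    have "map (tour_step \<rho> {}) (map (Pair x) xs) = map (Pair x) (map (\<rho> x) xs)"
      by (simp add: tour_step_def)
    then have "lists_cycle (tour_step \<rho> {}) (map (Pair x) xs)"
      using xs(1) by (auto simp: lists_cycle_def rotate1_map distinct_map inj_on_def simp del: map_map)
    moreover have "reach {} x = {x}"
      using reach_subsetI[of x "{x}" "{}"] by auto
    ultimately show ?case
      using xs(2) by (intro exI[of _ "map (Pair x) xs"]) (auto simp: darts_def)
  next
    case (insert \<epsilon> F)
    let ?v = "violet_end \<epsilon>" and ?e = "emerald_end \<epsilon>"
    have \<epsilon>: "\<epsilon> \<in> ?E" using insert.prems by simp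
    have F: "forest F" "F \<subseteq> ?E"
      using insert.prems by (auto intro: forest_subset)
    show ?case
    proof (cases "x \<in> reach F ?v \<union> reach F ?e")
      case True
      have inc: "\<epsilon> \<in> incident ?E ?v" "\<epsilon> \<in> incident ?E ?e"
        using \<epsilon> by (auto simp: incident_def endpoints_def)
      have "\<exists>as. lists_cycle (tour_step \<rho> F) (as @ [(z, \<epsilon>)]) \<and>
          set (as @ [(z, \<epsilon>)]) = darts ?E (reach F z)" if "z \<in> bip_nodes G" "\<epsilon> \<in> incident ?E z" for z
      proof -
        from insert.IH[OF F that(1)] that(2) obtain xs
          where xs: "lists_cycle (tour_step \<rho> F) xs" "set xs = darts ?E (reach F z)" by blast
        moreover have "(z, \<epsilon>) \<in> set xs" using that(2) xs(2) by (simp add: darts_def)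
        ultimately show ?thesis using lists_cycle_ending_with by metis
      qed
      then obtain as bs where
        as: "lists_cycle (tour_step \<rho> F) (as @ [(?v, \<epsilon>)])" "set (as @ [(?v, \<epsilon>)]) = darts ?E (reach F ?v)"
        and bs: "lists_cycle (tour_step \<rho> F) (bs @ [(?e, \<epsilon>)])" "set (bs @ [(?e, \<epsilon>)]) = darts ?E (reach F ?e)"
        using inc ends_in_bip_nodes[OF G(1) \<epsilon>] by metis
      have "lists_cycle (tour_step \<rho> (insert \<epsilon> F)) (as @ (?v, \<epsilon>) # bs @ [(?e, \<epsilon>)])"
        using insert.hyps(2) forest_insertD[OF insert.prems(1) insert.hyps(2)] as bs
        by (intro lists_cycle_insert_edge) (auto simp: endpoints_def)
      moreover have "set (as @ (?v, \<epsilon>) # bs @ [(?e, \<epsilon>)]) = darts ?E (reach (insert \<epsilon> F) x)"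
      proof -
        have "set (as @ (?v, \<epsilon>) # bs @ [(?e, \<epsilon>)]) = darts ?E (reach F ?v) \<union> darts ?E (reach F ?e)"
          unfolding as(2)[symmetric] bs(2)[symmetric] by auto
        then show ?thesis using True by (auto simp: reach_insert darts_def)
      qed
      ultimately show ?thesis by blast
    next
      case False
      from insert.IH[OF F insert.prems(3,4)] obtain xs
        where xs: "lists_cycle (tour_step \<rho> F) xs" "set xs = darts ?E (reach F x)" by blast
      have "?v \<notin> reach F x" "?e \<notin> reach F x" using False reach_sym by blast+
      then have "tour_step \<rho> (insert \<epsilon> F) d = tour_step \<rho> F d" if "d \<in> set xs" for d
        using that unfolding xs(2) by (auto simp: darts_def incident_def endpoints_def tour_step_def)
      then have "lists_cycle (tour_step \<rho> (insert \<epsilon> F)) xs"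
        using xs(1) lists_cycle_cong by metis
      then show ?thesis
        using xs(2) False by (auto simp: reach_insert)
    qed
  qed
qed

text \<open>Removing \<open>\<epsilon>\<close> leaves one cycle on each side, and putting it back
  concatenates them at the two darts of \<open>\<epsilon>\<close>. Started at the base, the merged
  cycle contains the far side as one uninterrupted block.\<close>

lemma tour_excursion:
  assumes G: "loopless_graph G" "ribbon_structure G \<rho>"
    and T: "forest T" "T \<subseteq> bip_edges G" "\<epsilon> \<in> T" "endpoints \<epsilon> = {x, y}"
    and b: "b \<in> reach (T - {\<epsilon>}) x" "\<beta> \<in> incident (bip_edges G) b"
  shows "\<exists>P Q R. tour \<rho> (b, \<beta>) T = P @ (x, \<epsilon>) # Q @ (y, \<epsilon>) # R \<and>
    set (P @ (x, \<epsilon>) # R) = darts (bip_edges G) (reach (T - {\<epsilon>}) x) \<and>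
    set (Q @ [(y, \<epsilon>)]) = darts (bip_edges G) (reach (T - {\<epsilon>}) y)"
proof -
  let ?E = "bip_edges G" and ?F = "T - {\<epsilon>}"
  have \<epsilon>: "\<epsilon> \<in> ?E" "insert \<epsilon> ?F = T" "\<epsilon> \<notin> ?F" using T by auto
  have F: "forest ?F" "?F \<subseteq> ?E" using T by (auto intro: forest_subset)
  have xy: "x \<in> bip_nodes G" "y \<in> bip_nodes G" "\<epsilon> \<in> incident ?E x" "\<epsilon> \<in> incident ?E y"
    using ends_in_bip_nodes[OF G(1) \<epsilon>(1)] T(4) \<epsilon>(1)
    by (auto simp: endpoints_def incident_def doubleton_eq_iff)
  have "\<exists>as. lists_cycle (tour_step \<rho> ?F) (as @ [(z, \<epsilon>)]) \<and>
      set (as @ [(z, \<epsilon>)]) = darts ?E (reach ?F z)" if "z \<in> bip_nodes G" "\<epsilon> \<in> incident ?E z" for z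
  proof -
    from forest_orbit[OF G F that(1)] that(2) obtain xs
      where xs: "lists_cycle (tour_step \<rho> ?F) xs" "set xs = darts ?E (reach ?F z)" by blast
    moreover have "(z, \<epsilon>) \<in> set xs" using that(2) xs(2) by (simp add: darts_def)
    ultimately show ?thesis using lists_cycle_ending_with by metis
  qed
  then obtain as bs where
    as: "lists_cycle (tour_step \<rho> ?F) (as @ [(x, \<epsilon>)])" "set (as @ [(x, \<epsilon>)]) = darts ?E (reach ?F x)"
    and bs: "lists_cycle (tour_step \<rho> ?F) (bs @ [(y, \<epsilon>)])" "set (bs @ [(y, \<epsilon>)]) = darts ?E (reach ?F y)"
    using xy by metis
  have "y \<notin> reach ?F x"
    using T(1,3,4) reach_sym by (fastforce simp: forest_def endpoints_def doubleton_eq_iff)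
  then have cyc: "lists_cycle (tour_step \<rho> T) (as @ (x, \<epsilon>) # bs @ [(y, \<epsilon>)])"
    using lists_cycle_insert_edge[OF \<epsilon>(3) T(4) _ as bs] \<epsilon>(2) by simp
  have "(b, \<beta>) \<in> set (as @ [(x, \<epsilon>)])" unfolding as(2) using b by (simp add: darts_def)
  then obtain us ws where uw: "as @ [(x, \<epsilon>)] = us @ (b, \<beta>) # ws"
    by (meson split_list)
  \<comment> \<open>The near cycle is cut at the base dart, and \<open>us\<close> moves to the end
    of the tour. If the base dart is \<open>(x, \<epsilon>)\<close> itself, \<open>P\<close> is
    empty.\<close>
  obtain P where P: "(b, \<beta>) # ws = P @ [(x, \<epsilon>)]" "as = us @ P"
    using uw by (cases ws rule: rev_cases) (auto simp: append_eq_append_conv2)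
  let ?t = "P @ (x, \<epsilon>) # bs @ (y, \<epsilon>) # us"
  have "lists_cycle (tour_step \<rho> T) ?t"
    using lists_cycle_append_commute[of _ us "P @ (x, \<epsilon>) # bs @ [(y, \<epsilon>)]"] cyc P(2) by simp
  moreover have "hd ?t = (b, \<beta>)"
    using P(1) by (cases P) auto
  ultimately have "tour \<rho> (b, \<beta>) T = ?t"
    by (rule tour_eqI)
  moreover have "set (P @ (x, \<epsilon>) # us) = darts ?E (reach ?F x)"
    using as(2) P(2) by auto
  ultimately show ?thesis using bs(2) by blast
qed

section \<open>Positions in the tour\<close>

text \<open>The first occurrence; the value is \<open>length xs\<close> if \<open>p\<close> does not
  occur.\<close>

definition index_of :: "'a list \<Rightarrow> 'a \<Rightarrow> nat" where
  "index_of xs p = length (takeWhile (\<lambda>q. q \<noteq> p) xs)"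

lemma index_of_Cons: "index_of (x # xs) p = (if x = p then 0 else Suc (index_of xs p))"
  by (simp add: index_of_def)

lemma index_of_append:
  "index_of (xs @ ys) p = (if p \<in> set xs then index_of xs p else length xs + index_of ys p)"
  by (induction xs) (auto simp: index_of_Cons)

lemma index_of_less: "p \<in> set xs \<Longrightarrow> index_of xs p < length xs"
  by (induction xs) (auto simp: index_of_Cons)

lemma nth_index_of: "p \<in> set xs \<Longrightarrow> xs ! index_of xs p = p"
  by (induction xs) (auto simp: index_of_Cons)

lemma index_of_nth: "distinct xs \<Longrightarrow> i < length xs \<Longrightarrow> index_of xs (xs ! i) = i"
  by (metis index_of_less nth_eq_iff_index_eq nth_index_of nth_mem)

lemma precedes_iff_index_of:
  assumes "distinct xs"
  shows "precedes xs p q \<longleftrightarrow> p \<in> set xs \<and> q \<in> set xs \<and> index_of xs p < index_of xs q"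
proof
  assume "precedes xs p q"
  then show "p \<in> set xs \<and> q \<in> set xs \<and> index_of xs p < index_of xs q"
    using index_of_nth[OF assms] by (auto simp: precedes_def)
next
  assume "p \<in> set xs \<and> q \<in> set xs \<and> index_of xs p < index_of xs q"
  then show "precedes xs p q"
    unfolding precedes_def using index_of_less nth_index_of by metis
qed

section \<open>A fixed Jaeger tree and the positions in its tour\<close>

locale jaeger_tree =
  fixes G :: "('v, 'e) hypergraph" and \<rho> :: "('v, 'e) ribbon"
    and b :: "('v, 'e) node" and \<beta> :: "('v, 'e) bip_edge" and T :: "('v, 'e) bip_edge set"
  assumes loopless: "loopless_graph G" and ribbon: "ribbon_structure G \<rho>"
    and base: "\<beta> \<in> incident (bip_edges G) b" and jaeger: "V_cut_Jaeger_tree G \<rho> (b, \<beta>) T"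
begin

abbreviation E where "E \<equiv> bip_edges G"

abbreviation t where "t \<equiv> tour \<rho> (b, \<beta>) T"

definition pos :: "('v, 'e) node \<Rightarrow> ('v, 'e) bip_edge \<Rightarrow> nat" where
  "pos x \<epsilon> = index_of t (x, \<epsilon>)"

abbreviation vpos where "vpos \<epsilon> \<equiv> pos (violet_end \<epsilon>) \<epsilon>"

abbreviation vside where "vside \<epsilon> \<equiv> reach (T - {\<epsilon>}) (violet_end \<epsilon>)"
abbreviation eside where "eside \<epsilon> \<equiv> reach (T - {\<epsilon>}) (emerald_end \<epsilon>)"

lemma ends_in_nodes [simp]:
  "\<epsilon> \<in> E \<Longrightarrow> violet_end \<epsilon> \<in> bip_nodes G" "\<epsilon> \<in> E \<Longrightarrow> emerald_end \<epsilon> \<in> bip_nodes G"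
  using ends_in_bip_nodes[OF loopless] by blast+

lemma spanning: "spanning_tree G T"
  using jaeger by (simp add: V_cut_Jaeger_tree_def)

lemma T_forest: "forest T" and T_subset: "T \<subseteq> E"
  using spanning spanning_tree_forest by (auto simp: spanning_tree_def)

lemma finite_E: "finite E" and finite_T: "finite T"
  using finite_bip_edges[OF loopless] T_subset finite_subset by blast+

lemma finite_nodes: "finite (bip_nodes G)"
  using loopless by (simp add: loopless_graph_def bip_nodes_def violet_nodes_def emerald_nodes_def)

lemma base_node: "b \<in> bip_nodes G"
  using base by (auto simp: incident_def endpoints_def)

lemma nodes_reach:
  assumes "spanning_tree G T'" "x \<in> bip_nodes G"
  shows "reach T' x = bip_nodes G"
proof
  show "reach T' x \<subseteq> bip_nodes G"
    using assms
    by (intro reach_subsetI) (auto simp: spanning_tree_def)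
  show "bip_nodes G \<subseteq> reach T' x"
    using assms by (auto simp: spanning_tree_def reach_def)
qed

text \<open>A spanning tree has a single component, so one cycle runs through all darts; rotating it
  to start at the base gives the tour.\<close>

lemma tour_cycle: "lists_cycle (tour_step \<rho> T) t"
  and set_tour: "set t = darts E (bip_nodes G)"
  and hd_tour: "hd t = (b, \<beta>)"
proof -
  have "incident E b \<noteq> {}" using base by blast
  from forest_orbit[OF loopless ribbon T_forest T_subset base_node this]
  obtain xs where xs: "lists_cycle (tour_step \<rho> T) xs" "set xs = darts E (bip_nodes G)"
    unfolding nodes_reach[OF spanning base_node] by blast
  have "(b, \<beta>) \<in> set xs" unfolding xs(2) using base base_node by (simp add: darts_def)
  then obtain us ws where uw: "xs = us @ (b, \<beta>) # ws" by (meson split_list)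
  have "lists_cycle (tour_step \<rho> T) (((b, \<beta>) # ws) @ us)"
    using lists_cycle_append_commute xs(1) unfolding uw by blast
  moreover from tour_eqI[OF this] have "t = ((b, \<beta>) # ws) @ us" by simp
  ultimately show "lists_cycle (tour_step \<rho> T) t" "set t = darts E (bip_nodes G)" "hd t = (b, \<beta>)"
    using xs(2) uw by auto
qed

lemma distinct_tour: "distinct t"
  using tour_cycle by (simp add: lists_cycle_def)

lemma in_tour: "\<epsilon> \<in> incident E x \<Longrightarrow> (x, \<epsilon>) \<in> set t"
  unfolding set_tour
  by (auto simp: darts_def incident_def endpoints_def)

lemma pos_eq_iff:
  assumes "\<epsilon> \<in> incident E x" "\<delta> \<in> incident E y"
  shows "pos x \<epsilon> = pos y \<delta> \<longleftrightarrow> x = y \<and> \<epsilon> = \<delta>"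
  using nth_index_of[OF in_tour[OF assms(1)]] nth_index_of[OF in_tour[OF assms(2)]]
  unfolding pos_def by (metis prod.inject)

lemma pos_base: "pos b \<beta> = 0"
  using hd_tour tour_cycle by (cases t) (auto simp: pos_def index_of_Cons lists_cycle_def)

text \<open>Positions advance by one except after the last entry of the tour; the later dart
  \<open>(z, \<eta>)\<close> ensures that \<open>(x, \<epsilon>)\<close> is not the last.\<close>

lemma pos_step:
  assumes "\<epsilon> \<in> incident E x" "tour_step \<rho> T (x, \<epsilon>) = (y, \<delta>)"
    and "\<eta> \<in> incident E z" "pos x \<epsilon> < pos z \<eta>"
  shows "pos y \<delta> = Suc (pos x \<epsilon>)"
proof -
  let ?i = "pos x \<epsilon>"
  have i: "Suc ?i < length t"
    using assms(4) index_of_less[OF in_tour[OF assms(3)]] by (simp add: pos_def)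
  have "t ! ?i = (x, \<epsilon>)"
    using nth_index_of[OF in_tour[OF assms(1)]] by (simp add: pos_def)
  then have "(y, \<delta>) = map (tour_step \<rho> T) t ! ?i"
    using i assms(2) by simp
  also have "\<dots> = t ! Suc ?i"
    using tour_cycle i by (simp add: lists_cycle_def nth_rotate1)
  finally show ?thesis
    using index_of_nth[OF distinct_tour i] by (simp add: pos_def)
qed

lemma incident_ends [simp]:
  "\<epsilon> \<in> incident F (violet_end \<epsilon>) \<longleftrightarrow> \<epsilon> \<in> F" "\<epsilon> \<in> incident F (emerald_end \<epsilon>) \<longleftrightarrow> \<epsilon> \<in> F"
  by (auto simp: incident_def endpoints_def)

lemma violet_less_iff:
  assumes "\<epsilon> \<in> E" "\<delta> \<in> E"
  shows "violet_less \<rho> (b, \<beta>) T \<epsilon> \<delta> \<longleftrightarrow> vpos \<epsilon> < vpos \<delta>"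
  using assms by (simp add: violet_less_def precedes_iff_index_of[OF distinct_tour] in_tour pos_def)

lemma cut_at_violet: "\<epsilon> \<in> E \<Longrightarrow> \<epsilon> \<notin> T \<Longrightarrow> vpos \<epsilon> < pos (emerald_end \<epsilon>) \<epsilon>"
  using jaeger by (auto simp: V_cut_Jaeger_tree_def precedes_iff_index_of[OF distinct_tour] pos_def)

lemma violet_node_less_iff:
  "violet_node_less G \<rho> (b, \<beta>) T x y \<longleftrightarrow>
    (\<exists>\<epsilon>\<in>incident E x. \<forall>\<delta>\<in>incident E y. vpos \<epsilon> < vpos \<delta>)"
  unfolding violet_node_less_def by (auto simp: violet_less_iff incident_def)

text \<open>In the decomposition of the tour at the two darts of \<open>\<epsilon>\<close>, the far
  side fills the block that ends with \<open>(y, \<epsilon>)\<close>, and the near side fills the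
  rest.\<close>

lemma excursion:
  assumes "\<epsilon> \<in> T" "endpoints \<epsilon> = {x, y}" "b \<in> reach (T - {\<epsilon>}) x" "\<delta> \<in> incident E z"
  shows excursion_far: "z \<in> reach (T - {\<epsilon>}) y \<Longrightarrow> pos x \<epsilon> < pos z \<delta> \<and> pos z \<delta> \<le> pos y \<epsilon>"
    and excursion_near: "z \<in> reach (T - {\<epsilon>}) x \<Longrightarrow> pos z \<delta> \<le> pos x \<epsilon> \<or> pos y \<epsilon> < pos z \<delta>"
proof -
  from tour_excursion[OF loopless ribbon T_forest T_subset assms(1-3) base]
  obtain P Q R where t: "t = P @ (x, \<epsilon>) # Q @ (y, \<epsilon>) # R"
    and near: "set (P @ (x, \<epsilon>) # R) = darts E (reach (T - {\<epsilon>}) x)"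
    and far: "set (Q @ [(y, \<epsilon>)]) = darts E (reach (T - {\<epsilon>}) y)"
    by blast
  have dist: "distinct (P @ (x, \<epsilon>) # Q @ (y, \<epsilon>) # R)" using distinct_tour t by simp
  show "pos x \<epsilon> < pos z \<delta> \<and> pos z \<delta> \<le> pos y \<epsilon>" if "z \<in> reach (T - {\<epsilon>}) y"
  proof -
    have "(z, \<delta>) \<in> set (Q @ [(y, \<epsilon>)])"
      unfolding far using that assms(4) by (simp add: darts_def)
    then have "(z, \<delta>) \<in> set Q \<or> (z, \<delta>) = (y, \<epsilon>)" by auto
    then show ?thesis
      unfolding pos_def t using dist index_of_less[of _ Q]
      by (auto simp: index_of_append index_of_Cons less_imp_le)
  qed
  show "pos z \<delta> \<le> pos x \<epsilon> \<or> pos y \<epsilon> < pos z \<delta>" if "z \<in> reach (T - {\<epsilon>}) x"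
  proof -
    have "(z, \<delta>) \<in> set (P @ (x, \<epsilon>) # R)"
      unfolding near using that assms(4) by (simp add: darts_def)
    then have "(z, \<delta>) \<in> set P \<or> (z, \<delta>) = (x, \<epsilon>) \<or> (z, \<delta>) \<in> set R" by auto
    then show ?thesis
      unfolding pos_def t using dist index_of_less[of _ P]
      by (auto simp: index_of_append index_of_Cons less_imp_le)
  qed
qed

subsection \<open>Semi-passive edges\<close>

lemma sides:
  assumes "\<epsilon> \<in> T"
  shows "vside \<epsilon> \<inter> eside \<epsilon> = {}" "vside \<epsilon> \<union> eside \<epsilon> = bip_nodes G"
proof -
  show "vside \<epsilon> \<inter> eside \<epsilon> = {}"
    using T_forest assms by (intro reach_disjoint) (auto simp: forest_def)
  have "reach (insert \<epsilon> (T - {\<epsilon>})) (violet_end \<epsilon>) = vside \<epsilon> \<union> eside \<epsilon>"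
    unfolding reach_insert by simp
  moreover have "insert \<epsilon> (T - {\<epsilon>}) = T" "\<epsilon> \<in> E" using assms T_subset by auto
  ultimately show "vside \<epsilon> \<union> eside \<epsilon> = bip_nodes G"
    using nodes_reach[OF spanning] by simp
qed

lemma tree_edge_sides:
  "\<delta> \<in> T \<Longrightarrow> \<delta> \<noteq> \<epsilon> \<Longrightarrow> violet_end \<delta> \<in> reach (T - {\<epsilon>}) x \<longleftrightarrow> emerald_end \<delta> \<in> reach (T - {\<epsilon>}) x"
  by (intro violet_in_reach_iff) auto

lemma components_remove:
  assumes "\<epsilon> \<in> T"
  shows "components G (T - {\<epsilon>}) = {vside \<epsilon>, eside \<epsilon>}"
proof -
  have ends: "violet_end \<epsilon> \<in> bip_nodes G" "emerald_end \<epsilon> \<in> bip_nodes G"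
    using assms T_subset by auto
  have side: "reach (T - {\<epsilon>}) x \<in> {vside \<epsilon>, eside \<epsilon>}" if "x \<in> bip_nodes G" for x
    using that sides(2)[OF assms] reach_eq by blast
  have "{y \<in> bip_nodes G. (x, y) \<in> (adjacent (T - {\<epsilon>}))\<^sup>*} = reach (T - {\<epsilon>}) x"
    if "x \<in> bip_nodes G" for x
  proof -
    have "reach (T - {\<epsilon>}) x \<subseteq> bip_nodes G"
      using side[OF that] sides(2)[OF assms] by blast
    then show ?thesis by (auto simp: reach_def)
  qed
  then have "components G (T - {\<epsilon>}) = reach (T - {\<epsilon>}) ` bip_nodes G"
    unfolding components_def Setcompr_eq_image by (rule image_cong[OF refl])
  moreover have "reach (T - {\<epsilon>}) ` bip_nodes G \<subseteq> {vside \<epsilon>, eside \<epsilon>}"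
    using side by (intro image_subsetI)
  moreover have "{vside \<epsilon>, eside \<epsilon>} \<subseteq> reach (T - {\<epsilon>}) ` bip_nodes G"
    using ends by simp
  ultimately show ?thesis by (metis subset_antisym)
qed

lemma fundamental_cut_iff:
  assumes "\<epsilon> \<in> T"
  shows "\<delta> \<in> fundamental_cut G T \<epsilon> \<longleftrightarrow> \<delta> \<in> E \<and>
    (violet_end \<delta> \<in> vside \<epsilon> \<and> emerald_end \<delta> \<in> eside \<epsilon> \<or>
     violet_end \<delta> \<in> eside \<epsilon> \<and> emerald_end \<delta> \<in> vside \<epsilon>)"
  using sides(1)[OF assms] reach_refl
  unfolding fundamental_cut_def components_remove[OF assms] endpoints_def by blast

text \<open>The edge \<open>\<delta>\<close> crosses the cut of \<open>\<epsilon>\<close> with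
  colours reversed, and the base lies on the emerald side. The existence of such a
  \<open>\<delta>\<close> will replace semi-passivity, without reference to a smallest edge.\<close>

definition reversing :: "('v, 'e) bip_edge \<Rightarrow> ('v, 'e) bip_edge \<Rightarrow> bool" where
  "reversing \<epsilon> \<delta> \<longleftrightarrow> \<epsilon> \<in> T \<and> b \<in> eside \<epsilon> \<and> \<delta> \<in> E \<and>
     violet_end \<delta> \<in> eside \<epsilon> \<and> emerald_end \<delta> \<in> vside \<epsilon>"

lemma reversing_not_in_tree:
  assumes "reversing \<epsilon> \<delta>"
  shows "\<delta> \<notin> T"
proof
  assume "\<delta> \<in> T"
  have "\<epsilon> \<in> T" "violet_end \<delta> \<in> eside \<epsilon>" "emerald_end \<delta> \<in> vside \<epsilon>"
    using assms by (auto simp: reversing_def)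
  moreover from this sides(1) have "\<delta> \<noteq> \<epsilon>" using reach_refl by blast
  ultimately show False
    using sides(1) tree_edge_sides[OF \<open>\<delta> \<in> T\<close>] by blast
qed

lemma is_violet_ends [simp]: "is_violet (violet_end \<epsilon>)" "\<not> is_violet (emerald_end \<epsilon>)"
  by (auto simp: violet_end_def emerald_end_def)

lemma endpoints_emerald_violet: "endpoints \<epsilon> = {emerald_end \<epsilon>, violet_end \<epsilon>}"
  by (auto simp: endpoints_def)

lemma endpoints_violet_emerald: "endpoints \<epsilon> = {violet_end \<epsilon>, emerald_end \<epsilon>}"
  by (auto simp: endpoints_def)

lemma excursion_from_emerald:
  assumes "\<epsilon> \<in> T" "b \<in> eside \<epsilon>" "\<delta> \<in> incident E z" "z \<in> vside \<epsilon>"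
  shows "pos (emerald_end \<epsilon>) \<epsilon> < pos z \<delta>"
  using excursion_far[OF assms(1) endpoints_emerald_violet assms(2-4)] by simp

text \<open>The emerald dart of \<open>\<delta>\<close> falls into the excursion across
  \<open>\<epsilon>\<close>. The violet dart comes earlier, as \<open>\<delta>\<close> is cut there,
  and lies on the base side, so it comes before the excursion.\<close>

lemma reversing_pos:
  assumes "reversing \<epsilon> \<delta>"
  shows "vpos \<delta> < pos (emerald_end \<epsilon>) \<epsilon>"
proof -
  have r: "\<epsilon> \<in> T" "b \<in> eside \<epsilon>" "\<delta> \<in> E" "violet_end \<delta> \<in> eside \<epsilon>" "emerald_end \<delta> \<in> vside \<epsilon>"
    using assms by (auto simp: reversing_def)
  have "vpos \<delta> < pos (emerald_end \<delta>) \<delta>"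
    using r(3) reversing_not_in_tree[OF assms] by (rule cut_at_violet)
  also have "\<dots> \<le> vpos \<epsilon>"
    using excursion_far[OF r(1) endpoints_emerald_violet r(2) _ r(5), of \<delta>] r(3) by simp
  finally have "vpos \<delta> \<le> pos (emerald_end \<epsilon>) \<epsilon>"
    using excursion_near[OF r(1) endpoints_emerald_violet r(2) _ r(4), of \<delta>] r(3) by simp
  moreover have "vpos \<delta> \<noteq> pos (emerald_end \<epsilon>) \<epsilon>"
    using r(1,3) T_subset by (subst pos_eq_iff) auto
  ultimately show ?thesis by simp
qed

text \<open>If the base node is on the violet side of \<open>\<epsilon>\<close>, then \<open>\<epsilon>\<close> precedes every edge of its cut
  whose violet end is on the emerald side. Otherwise all edges of the cut with violet end on the
  emerald side precede the others, because they are cut at their violet end.\<close>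

lemma semi_passive_iff:
  "internally_semi_passive G (violet_less \<rho> (b, \<beta>) T) T \<epsilon> \<longleftrightarrow> (\<exists>\<delta>. reversing \<epsilon> \<delta>)"
proof
  assume "internally_semi_passive G (violet_less \<rho> (b, \<beta>) T) T \<epsilon>"
  then obtain \<delta> where \<epsilon>: "\<epsilon> \<in> T" and \<delta>: "\<delta> \<in> fundamental_cut G T \<epsilon>"
    and min: "\<And>\<delta>'. \<delta>' \<in> fundamental_cut G T \<epsilon> \<Longrightarrow> \<delta>' \<noteq> \<delta> \<Longrightarrow> violet_less \<rho> (b, \<beta>) T \<delta> \<delta>'"
    and col: "\<And>K. K \<in> components G (T - {\<epsilon>}) \<Longrightarrow>
      \<exists>x\<in>endpoints \<delta> \<inter> K. \<exists>y\<in>endpoints \<epsilon> \<inter> K. is_violet x \<noteq> is_violet y"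
    unfolding internally_semi_passive_def by blast
  have \<epsilon>E: "\<epsilon> \<in> E" and \<delta>E: "\<delta> \<in> E"
    using \<epsilon> T_subset \<delta> by (auto simp: fundamental_cut_def)
  have nin: "violet_end \<epsilon> \<notin> eside \<epsilon>" "emerald_end \<epsilon> \<notin> vside \<epsilon>"
    using sides(1)[OF \<epsilon>] reach_refl by blast+
  have d: "violet_end \<delta> \<in> eside \<epsilon>" "emerald_end \<delta> \<in> vside \<epsilon>"
    using col[of "eside \<epsilon>"] col[of "vside \<epsilon>"] nin
    unfolding components_remove[OF \<epsilon>] by (auto simp: endpoints_def)
  have "b \<in> eside \<epsilon>"
  proof (rule ccontr)
    assume "b \<notin> eside \<epsilon>"
    then have b: "b \<in> vside \<epsilon>" using sides(2)[OF \<epsilon>] base_node by auto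
    have "vpos \<epsilon> < vpos \<delta>"
      using excursion_far[OF \<epsilon> endpoints_violet_emerald b _ d(1), of \<delta>] \<delta>E by simp
    moreover have "\<epsilon> \<in> fundamental_cut G T \<epsilon>"
      using \<epsilon>E by (simp add: fundamental_cut_iff[OF \<epsilon>])
    moreover have "\<epsilon> \<noteq> \<delta>" using d nin by auto
    ultimately show False
      using min[of \<epsilon>] violet_less_iff[OF \<delta>E \<epsilon>E] by simp
  qed
  then show "\<exists>\<delta>. reversing \<epsilon> \<delta>"
    using \<epsilon> \<delta>E d unfolding reversing_def by blast
next
  assume "\<exists>\<delta>. reversing \<epsilon> \<delta>"
  then obtain \<delta>\<^sub>0 where \<delta>\<^sub>0: "reversing \<epsilon> \<delta>\<^sub>0" by blast
  then have \<epsilon>: "\<epsilon> \<in> T" and b: "b \<in> eside \<epsilon>" by (auto simp: reversing_def)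
  let ?C = "fundamental_cut G T \<epsilon>"
  have "finite ?C" using finite_E by (rule rev_finite_subset) (auto simp: fundamental_cut_def)
  moreover have C: "\<delta>\<^sub>0 \<in> ?C" using \<delta>\<^sub>0 by (auto simp: reversing_def fundamental_cut_iff)
  ultimately obtain \<delta> where \<delta>: "\<delta> \<in> ?C" "\<And>\<delta>'. \<delta>' \<in> ?C \<Longrightarrow> vpos \<delta> \<le> vpos \<delta>'"
    using ex_is_arg_min_if_finite[of ?C vpos] unfolding is_arg_min_def by (metis empty_iff not_le)
  have \<delta>E: "\<delta> \<in> E" using \<delta> by (simp add: fundamental_cut_def)
  \<comment> \<open>With its violet end on the far side, \<open>\<delta>\<close> would come after
    the crossing of \<open>\<epsilon>\<close>, but \<open>\<delta>\<^sub>0\<close> comes before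
    it.\<close>
  have "violet_end \<delta> \<notin> vside \<epsilon>"
    using excursion_from_emerald[OF \<epsilon> b, of \<delta> "violet_end \<delta>"] \<delta>(2)[OF C] reversing_pos[OF \<delta>\<^sub>0] \<delta>E
    by auto
  then have d: "violet_end \<delta> \<in> eside \<epsilon>" "emerald_end \<delta> \<in> vside \<epsilon>"
    using \<delta>(1) by (auto simp: fundamental_cut_iff[OF \<epsilon>])
  have "violet_less \<rho> (b, \<beta>) T \<delta> \<delta>'" if \<delta>': "\<delta>' \<in> ?C" "\<delta>' \<noteq> \<delta>" for \<delta>'
  proof -
    have "\<delta>' \<in> E" using \<delta>' by (simp add: fundamental_cut_def)
    then have "vpos \<delta> \<noteq> vpos \<delta>'" using \<delta>E \<delta>'(2) by (subst pos_eq_iff) auto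
    then show ?thesis using \<delta>(2)[OF \<delta>'(1)] violet_less_iff[OF \<delta>E \<open>\<delta>' \<in> E\<close>] by simp
  qed
  moreover have "\<exists>x\<in>endpoints \<delta> \<inter> K. \<exists>y\<in>endpoints \<epsilon> \<inter> K. is_violet x \<noteq> is_violet y"
    if "K \<in> components G (T - {\<epsilon>})" for K
    using that d reach_refl unfolding components_remove[OF \<epsilon>] endpoints_def
    by (metis IntI insertCI is_violet_ends singletonD insertE)
  ultimately show "internally_semi_passive G (violet_less \<rho> (b, \<beta>) T) T \<epsilon>"
    unfolding internally_semi_passive_def using \<epsilon> \<delta>(1) by blast
qed

subsection \<open>Exchanging a semi-passive edge\<close>

lemma finite_incident [simp]: "finite (incident E x)" "finite (incident T x)"
  using finite_E finite_T by (auto simp: incident_def)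

lemma incident_T_subset: "incident T x \<subseteq> incident E x"
  using T_subset by (auto simp: incident_def)

text \<open>The two ends of the base edge provide, for each node, another node to which the tree
  must connect it.\<close>

lemma degree_pos:
  assumes "spanning_tree G T'" "x \<in> bip_nodes G"
  shows "degree T' x \<ge> 1"
proof -
  have "finite T'"
    using assms(1) finite_E by (auto simp: spanning_tree_def intro: finite_subset)
  have "\<beta> \<in> E" using base by (auto simp: incident_def)
  then obtain y where y: "y \<in> bip_nodes G" "y \<noteq> x"
    using ends_in_nodes[of \<beta>] ends_neq(1)[of \<beta> \<beta>] by metis
  have "(x, y) \<in> (adjacent T')\<^sup>*"
    using assms y by (auto simp: spanning_tree_def)
  then obtain z where "(x, z) \<in> adjacent T'"
    using y(2) by (auto elim: converse_rtranclE)
  then have "incident T' x \<noteq> {}"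
    by (auto simp: adjacent_def incident_def)
  moreover have "finite (incident T' x)" using \<open>finite T'\<close> by (auto simp: incident_def)
  ultimately show ?thesis by (simp add: degree_def Suc_le_eq card_gt_0_iff)
qed

lemma hypertreeI:
  assumes "spanning_tree G T'" "X \<subseteq> bip_nodes G" "\<And>x. x \<in> X \<Longrightarrow> int (degree T' x) = f x + 1"
  shows "hypertree G X f"
  unfolding hypertree_def using assms degree_pos by fastforce

text \<open>The tree \<open>T - {\<epsilon>}\<close> with \<open>\<delta>\<close> added realises the
  exchange. A colour class meets each edge in one end, so one argument serves both classes.\<close>

lemma exchange_hypertree:
  assumes r: "reversing \<epsilon> \<delta>" and X: "X \<subseteq> bip_nodes G"
    and x: "X \<inter> endpoints \<epsilon> = {x}" and x': "X \<inter> endpoints \<delta> = {x'}"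
  shows "hypertree G X ((hypertree_of T)(x := hypertree_of T x - 1, x' := hypertree_of T x' + 1))"
proof (rule hypertreeI[OF _ X])
  let ?T' = "insert \<delta> (T - {\<epsilon>})"
  have r': "\<epsilon> \<in> T" "\<delta> \<in> E" "violet_end \<delta> \<in> eside \<epsilon>" "emerald_end \<delta> \<in> vside \<epsilon>"
    using r by (auto simp: reversing_def)
  show "spanning_tree G ?T'"
    using spanning_tree_exchange[OF spanning r'] .
  \<comment> \<open>Equally coloured ends of \<open>\<epsilon>\<close> and \<open>\<delta>\<close>
    lie on opposite sides, so the loss and the gain of degree occur at different nodes.\<close>
  have "violet_end \<epsilon> \<noteq> violet_end \<delta>" "emerald_end \<epsilon> \<noteq> emerald_end \<delta>"
    using r'(3,4) sides(1)[OF r'(1)] reach_refl by (metis disjoint_iff)+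
  then have "endpoints \<epsilon> \<inter> endpoints \<delta> = {}"
    by (auto simp: endpoints_def)
  then have neq: "x \<notin> endpoints \<delta>" "x' \<notin> endpoints \<epsilon>" "x \<noteq> x'"
    using x x' by auto
  fix y assume y: "y \<in> X"
  have "\<delta> \<notin> T" using r by (rule reversing_not_in_tree)
  consider "y = x" | "y = x'" | "y \<noteq> x" "y \<noteq> x'" by blast
  then show "int (degree ?T' y) =
      ((hypertree_of T)(x := hypertree_of T x - 1, x' := hypertree_of T x' + 1)) y + 1"
  proof cases
    case 1
    have "incident ?T' x = incident T x - {\<epsilon>}" "\<epsilon> \<in> incident T x"
      using neq x r'(1) by (auto simp: incident_def)
    then have "degree T x = Suc (degree ?T' x)"
      unfolding degree_def using card.remove[OF finite_incident(2)] by metis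
    then show ?thesis using 1 neq by (simp add: hypertree_of_def)
  next
    case 2
    have "incident ?T' x' = insert \<delta> (incident T x')" "\<delta> \<notin> incident T x'"
      using neq x' \<open>\<delta> \<notin> T\<close> by (auto simp: incident_def)
    then have "degree ?T' x' = Suc (degree T x')"
      by (simp add: degree_def)
    then show ?thesis using 2 neq by (simp add: hypertree_of_def)
  next
    case 3
    then have "y \<notin> endpoints \<epsilon>" "y \<notin> endpoints \<delta>" using y x x' by auto
    then have "incident ?T' y = incident T y" by (auto simp: incident_def)
    then show ?thesis using 3 by (simp add: hypertree_of_def degree_def)
  qed
qed

lemma color_nodes_endpoints:
  "\<epsilon> \<in> E \<Longrightarrow> violet_nodes G \<inter> endpoints \<epsilon> = {violet_end \<epsilon>}"
  "\<epsilon> \<in> E \<Longrightarrow> emerald_nodes G \<inter> endpoints \<epsilon> = {emerald_end \<epsilon>}"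
  using ends_in_nodes[of \<epsilon>]
  by (auto simp: bip_nodes_def violet_nodes_def emerald_nodes_def endpoints_def violet_end_def
      emerald_end_def)

lemma color_nodes: "violet_nodes G \<subseteq> bip_nodes G" "emerald_nodes G \<subseteq> bip_nodes G"
  by (auto simp: bip_nodes_def)

lemma at_emerald_end:
  "\<delta> \<in> incident F (emerald_end \<epsilon>) \<longleftrightarrow> \<delta> \<in> F \<and> emerald_end \<delta> = emerald_end \<epsilon>"
  by (auto simp: incident_def endpoints_def)

lemma at_violet_end:
  "\<delta> \<in> incident F (violet_end \<epsilon>) \<longleftrightarrow> \<delta> \<in> F \<and> violet_end \<delta> = violet_end \<epsilon>"
  by (auto simp: incident_def endpoints_def)

text \<open>All darts at the violet end of \<open>\<epsilon>\<close> come after the crossing of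
  \<open>\<epsilon>\<close>, while the violet dart of \<open>\<delta>\<close> comes before it. So
  the violet end of \<open>\<delta>\<close> is a smaller node to which degree can be moved.\<close>

lemma violet_inactive_if_reversing:
  assumes r: "reversing \<epsilon> \<delta>"
  shows "internally_inactive G (violet_nodes G) (violet_node_less G \<rho> (b, \<beta>) T) (hypertree_of T)
    (violet_end \<epsilon>)"
proof -
  have e: "\<epsilon> \<in> E" "\<delta> \<in> E" "\<epsilon> \<in> T" "b \<in> eside \<epsilon>"
    using r T_subset by (auto simp: reversing_def)
  have "vpos \<delta> < vpos \<eta>" if "\<eta> \<in> incident E (violet_end \<epsilon>)" for \<eta>
  proof -
    have "pos (emerald_end \<epsilon>) \<epsilon> < pos (violet_end \<epsilon>) \<eta>"
      using excursion_from_emerald[OF e(3,4) that] by simp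
    then show ?thesis
      using reversing_pos[OF r] that by (simp add: at_violet_end)
  qed
  then have "violet_node_less G \<rho> (b, \<beta>) T (violet_end \<delta>) (violet_end \<epsilon>)"
    unfolding violet_node_less_iff using e(2) by (intro bexI[of _ \<delta>]) auto
  then show ?thesis
    unfolding internally_inactive_def
    using exchange_hypertree[OF r color_nodes(1) color_nodes_endpoints(1)[OF e(1)] color_nodes_endpoints(1)[OF e(2)]]
      color_nodes_endpoints(1)[OF e(1)] color_nodes_endpoints(1)[OF e(2)] by blast
qed

text \<open>This is where it is used that \<open>G\<close> is a graph.\<close>

lemma other_edge:
  assumes "\<epsilon> \<in> E"
  shows "\<exists>\<zeta>. \<zeta> \<noteq> \<epsilon> \<and> incident E (emerald_end \<epsilon>) = {\<epsilon>, \<zeta>}"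
proof -
  obtain e v where ev: "\<epsilon> = (e, v)" by (cases \<epsilon>)
  have "e \<in> hedges G" "v \<in> hends G e" using assms ev by (auto simp: bip_edges_def)
  moreover from this have "card (hends G e) = 2" using loopless by (auto simp: loopless_graph_def)
  ultimately obtain w where "hends G e = {v, w}" "w \<noteq> v"
    by (auto simp: card_2_iff) (metis insert_commute)
  moreover have "incident E (emerald_end \<epsilon>) = Pair e ` hends G e"
    using \<open>e \<in> hedges G\<close>
    by (auto simp: ev incident_def endpoints_def bip_edges_def emerald_end_def violet_end_def)
  ultimately show ?thesis
    by (intro exI[of _ "(e, w)"]) (simp add: ev)
qed

text \<open>At an emerald node of degree two in \<open>T\<close> with tree edges \<open>\<epsilon>\<close>, \<open>\<zeta>\<close>, the hypothesis on the
  base says that the tour reaches the node along \<open>\<zeta>\<close>, or starts there and leaves along \<open>\<zeta>\<close> first.\<close>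

definition enters_via :: "('v, 'e) bip_edge \<Rightarrow> ('v, 'e) bip_edge \<Rightarrow> bool" where
  "enters_via \<zeta> \<epsilon> \<longleftrightarrow> \<epsilon> \<noteq> \<zeta> \<and> emerald_end \<zeta> = emerald_end \<epsilon> \<and>
     incident T (emerald_end \<epsilon>) = {\<epsilon>, \<zeta>} \<and> (b \<in> vside \<zeta> \<or> (b, \<beta>) = (emerald_end \<zeta>, \<zeta>))"

lemma eside_degree_two:
  assumes "incident T (emerald_end \<epsilon>) = {\<epsilon>, \<zeta>}" "\<epsilon> \<noteq> \<zeta>"
  shows "eside \<zeta> = insert (emerald_end \<epsilon>) (vside \<epsilon>)" "eside \<epsilon> = insert (emerald_end \<epsilon>) (vside \<zeta>)"
proof -
  have "\<zeta> \<in> incident T (emerald_end \<epsilon>)" using assms by simp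
  then have eq: "emerald_end \<zeta> = emerald_end \<epsilon>" by (simp add: at_emerald_end)
  have z: "endpoints \<zeta> = {emerald_end \<epsilon>, violet_end \<zeta>}"
    using endpoints_emerald_violet[of \<zeta>] eq by simp
  show "eside \<zeta> = insert (emerald_end \<epsilon>) (vside \<epsilon>)"
    using reach_remove_at_degree_two[OF T_forest assms endpoints_emerald_violet] eq by simp
  show "eside \<epsilon> = insert (emerald_end \<epsilon>) (vside \<zeta>)"
    using assms by (intro reach_remove_at_degree_two[OF T_forest _ _ z]) auto
qed

lemma enters_via_tree:
  assumes "enters_via \<zeta> \<epsilon>"
  shows "\<epsilon> \<in> T" "\<zeta> \<in> T" "b \<in> eside \<epsilon>"
proof -
  have inc: "incident T (emerald_end \<epsilon>) = {\<epsilon>, \<zeta>}" "\<epsilon> \<noteq> \<zeta>" "emerald_end \<zeta> = emerald_end \<epsilon>"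
    and b: "b \<in> vside \<zeta> \<or> (b, \<beta>) = (emerald_end \<zeta>, \<zeta>)"
    using assms by (auto simp: enters_via_def)
  show "\<epsilon> \<in> T" "\<zeta> \<in> T" using inc(1) by (auto simp: incident_def)
  show "b \<in> eside \<epsilon>"
    using b inc(3) unfolding eside_degree_two(2)[OF inc(1,2)] by auto
qed

text \<open>If the base is on the violet side of \<open>\<zeta>\<close>, the darts behind
  \<open>\<epsilon>\<close> belong to the excursion across \<open>\<zeta>\<close>, which begins
  right after the violet dart of \<open>\<zeta>\<close>. If the tour starts with the emerald dart of
  \<open>\<zeta>\<close>, that excursion comes first, covers \<open>vside \<zeta>\<close> and ends
  with the violet dart of \<open>\<zeta>\<close>.\<close>

lemma enters_via_pos:
  assumes z: "enters_via \<zeta> \<epsilon>" and q: "\<eta> \<in> incident E y" "y \<in> vside \<epsilon>"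
  shows "vpos \<zeta> < pos y \<eta>"
    and "\<delta> \<in> incident E x \<Longrightarrow> x \<in> vside \<zeta> \<Longrightarrow> pos x \<delta> < pos y \<eta> \<Longrightarrow> pos x \<delta> \<le> vpos \<zeta>"
proof -
  have inc: "incident T (emerald_end \<epsilon>) = {\<epsilon>, \<zeta>}" "\<epsilon> \<noteq> \<zeta>" "emerald_end \<zeta> = emerald_end \<epsilon>"
    and b: "b \<in> vside \<zeta> \<or> (b, \<beta>) = (emerald_end \<zeta>, \<zeta>)"
    using z by (auto simp: enters_via_def)
  note T = enters_via_tree[OF z]
  have y: "y \<in> eside \<zeta>"
    using eside_degree_two(1)[OF inc(1,2)] q(2) by simp
  have y': "y \<noteq> emerald_end \<zeta>"
    using q(2) sides(1)[OF T(1)] reach_refl[of "emerald_end \<epsilon>" "T - {\<epsilon>}"] inc(3) by auto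
  have "vpos \<zeta> < pos y \<eta> \<and> (\<delta> \<in> incident E x \<longrightarrow> x \<in> vside \<zeta> \<longrightarrow> pos x \<delta> < pos y \<eta> \<longrightarrow> pos x \<delta> \<le> vpos \<zeta>)"
  proof (cases "b \<in> vside \<zeta>")
    case True
    show ?thesis
      using excursion_far[OF T(2) endpoints_violet_emerald True q(1) y]
        excursion_near[OF T(2) endpoints_violet_emerald True, of \<delta> x] by auto
  next
    case False
    then have b: "b = emerald_end \<zeta>" "\<beta> = \<zeta>" using b by auto
    have b': "b \<in> eside \<zeta>" by (simp add: b)
    have 0: "pos (emerald_end \<zeta>) \<zeta> = 0" using pos_base b by simp
    have "\<zeta> \<in> E" using T T_subset by auto
    then have "pos y \<eta> \<noteq> pos (emerald_end \<zeta>) \<zeta>"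
      using y' q(1) by (subst pos_eq_iff) auto
    then show ?thesis
      using excursion_near[OF T(2) endpoints_emerald_violet b' q(1) y] 0
        excursion_far[OF T(2) endpoints_emerald_violet b', of \<delta> x] by auto
  qed
  then show "vpos \<zeta> < pos y \<eta>"
    "\<delta> \<in> incident E x \<Longrightarrow> x \<in> vside \<zeta> \<Longrightarrow> pos x \<delta> < pos y \<eta> \<Longrightarrow> pos x \<delta> \<le> vpos \<zeta>"
    by auto
qed

text \<open>If \<open>\<zeta>\<close> were not in \<open>T\<close>, the emerald end of
  \<open>\<epsilon>\<close> would be a leaf, leaving no room for the violet end of
  \<open>\<delta>\<close> on its side. A tour starting with the emerald dart of
  \<open>\<epsilon>\<close> would leave no earlier position for \<open>\<delta>\<close>.\<close>

lemma enters_via_if_reversing: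
  assumes r: "reversing \<epsilon> \<delta>" and inc: "incident E (emerald_end \<epsilon>) = {\<epsilon>, \<zeta>}" "\<zeta> \<noteq> \<epsilon>"
  shows "enters_via \<zeta> \<epsilon>"
proof -
  have r': "\<epsilon> \<in> T" "b \<in> eside \<epsilon>" "\<delta> \<in> E" "violet_end \<delta> \<in> eside \<epsilon>" "emerald_end \<delta> \<in> vside \<epsilon>"
    using r by (auto simp: reversing_def)
  have \<zeta>: "emerald_end \<zeta> = emerald_end \<epsilon>"
    using at_emerald_end[of \<zeta> E \<epsilon>] inc(1) by simp
  have sub: "incident T (emerald_end \<epsilon>) \<subseteq> {\<epsilon>, \<zeta>}"
    using incident_T_subset inc(1) by auto
  have "\<zeta> \<in> T"
  proof (rule ccontr)
    assume "\<zeta> \<notin> T"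
    have "eside \<epsilon> \<subseteq> {emerald_end \<epsilon>}"
    proof (rule reach_subsetI)
      fix \<eta> assume \<eta>: "\<eta> \<in> T - {\<epsilon>}"
      then have "emerald_end \<eta> \<noteq> emerald_end \<epsilon>"
        using sub \<open>\<zeta> \<notin> T\<close> at_emerald_end[of \<eta> T \<epsilon>] by auto
      then show "violet_end \<eta> \<in> {emerald_end \<epsilon>} \<longleftrightarrow> emerald_end \<eta> \<in> {emerald_end \<epsilon>}" by simp
    qed simp
    then show False using r'(4) by auto
  qed
  then have incT: "incident T (emerald_end \<epsilon>) = {\<epsilon>, \<zeta>}"
    using sub r'(1) \<zeta> at_emerald_end[of \<zeta> T \<epsilon>] at_emerald_end[of \<epsilon> T \<epsilon>] by auto
  have "b \<in> vside \<zeta> \<or> (b, \<beta>) = (emerald_end \<zeta>, \<zeta>)"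
  proof (rule ccontr)
    assume n: "\<not> ?thesis"
    then have b: "b = emerald_end \<epsilon>"
      using r'(2) eside_degree_two(2)[OF incT] inc(2) by auto
    then have "\<beta> \<in> {\<epsilon>, \<zeta>}" using base inc(1) by simp
    then have "\<beta> = \<epsilon>" using n b \<zeta> by auto
    then show False using reversing_pos[OF r] pos_base b by simp
  qed
  then show ?thesis using incT inc(2) \<zeta> by (auto simp: enters_via_def)
qed

text \<open>The violet dart of \<open>\<delta>\<close> precedes those of \<open>\<epsilon>\<close>
  and \<open>\<zeta>\<close>, the only two edges at the emerald end of \<open>\<epsilon>\<close>.
  Hence the emerald end of \<open>\<delta>\<close> is smaller.\<close>

lemma emerald_inactive_if_reversing:
  assumes r: "reversing \<epsilon> \<delta>"
  shows "internally_inactive G (emerald_nodes G) (violet_node_less G \<rho> (b, \<beta>) T) (hypertree_of T)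
    (emerald_end \<epsilon>)"
proof -
  have e: "\<epsilon> \<in> E" "\<delta> \<in> E" "\<epsilon> \<in> T" "b \<in> eside \<epsilon>" "violet_end \<delta> \<in> eside \<epsilon>" "emerald_end \<delta> \<in> vside \<epsilon>"
    using r T_subset by (auto simp: reversing_def)
  obtain \<zeta> where inc: "incident E (emerald_end \<epsilon>) = {\<epsilon>, \<zeta>}" "\<zeta> \<noteq> \<epsilon>"
    using other_edge[OF e(1)] by blast
  have z: "enters_via \<zeta> \<epsilon>" using r inc by (rule enters_via_if_reversing)
  have \<zeta>: "emerald_end \<zeta> = emerald_end \<epsilon>" "\<zeta> \<in> E" and d: "violet_end \<delta> \<in> vside \<zeta>"
    using z e(5) T_subset enters_via_tree(2)[OF z] eside_degree_two(2)[of \<epsilon> \<zeta>]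
    by (auto simp: enters_via_def)
  have "vpos \<delta> < pos (emerald_end \<delta>) \<delta>"
    using cut_at_violet[OF e(2) reversing_not_in_tree[OF r]] .
  then have "vpos \<delta> \<le> vpos \<zeta>"
    using enters_via_pos(2)[OF z _ e(6) _ d, of \<delta> \<delta>] e(2) by simp
  moreover have "vpos \<delta> \<noteq> vpos \<zeta>"
    using e(2,3,6) \<zeta> sides(1)[OF e(3)] reach_refl[of "emerald_end \<epsilon>" "T - {\<epsilon>}"]
    by (subst pos_eq_iff) auto
  moreover have "vpos \<delta> < vpos \<epsilon>"
    using reversing_pos[OF r] excursion_from_emerald[OF e(3,4), of \<epsilon> "violet_end \<epsilon>"] e(1) by simp
  ultimately have "violet_node_less G \<rho> (b, \<beta>) T (emerald_end \<delta>) (emerald_end \<epsilon>)"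
    unfolding violet_node_less_iff inc(1) using e(2) by (intro bexI[of _ \<delta>]) auto
  then show ?thesis
    unfolding internally_inactive_def
    using exchange_hypertree[OF r color_nodes(2) color_nodes_endpoints(2)[OF e(1)] color_nodes_endpoints(2)[OF e(2)]]
      color_nodes_endpoints(2)[OF e(1)] color_nodes_endpoints(2)[OF e(2)] by blast
qed

text \<open>A violet node has only one edge towards the base. Two such edges at an emerald node
  would each be the entering edge of the other; as the base is on the emerald side of both, the tour
  would have two different first darts.\<close>

lemma reversing_unique:
  assumes r: "reversing \<epsilon> \<delta>" "reversing \<epsilon>' \<delta>'" and x: "x \<in> endpoints \<epsilon>" "x \<in> endpoints \<epsilon>'"
  shows "\<epsilon> = \<epsilon>'"
proof (rule ccontr)
  assume neq: "\<epsilon> \<noteq> \<epsilon>'"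
  have T: "\<epsilon> \<in> T" "\<epsilon>' \<in> T" "b \<in> eside \<epsilon>" "b \<in> eside \<epsilon>'"
    using r by (auto simp: reversing_def)
  consider "violet_end \<epsilon> = violet_end \<epsilon>'" | "emerald_end \<epsilon> = emerald_end \<epsilon>'"
    using x by (auto simp: endpoints_def)
  then show False
  proof cases
    case 1
    then have "violet_end \<epsilon> \<in> endpoints \<epsilon>'" by (simp add: endpoints_def)
    from reach_remove_adjacent_edge[OF T_forest T(1) neq endpoints_violet_emerald this]
    have "b \<in> vside \<epsilon>'" using T(3) 1 by auto
    then show False using T(4) sides(1)[OF T(2)] by blast
  next
    case 2
    have "\<epsilon> \<in> E" "\<epsilon>' \<in> incident E (emerald_end \<epsilon>)"
      using T T_subset 2 by (auto simp: at_emerald_end)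
    then have inc: "incident E (emerald_end \<epsilon>) = {\<epsilon>, \<epsilon>'}"
      using other_edge[of \<epsilon>] neq by auto
    then have "incident E (emerald_end \<epsilon>') = {\<epsilon>', \<epsilon>}" using 2 by auto
    then have "enters_via \<epsilon>' \<epsilon>" "enters_via \<epsilon> \<epsilon>'"
      using enters_via_if_reversing[OF r(1) inc] enters_via_if_reversing[OF r(2)] neq by auto
    then have "(b, \<beta>) = (emerald_end \<epsilon>', \<epsilon>')" "(b, \<beta>) = (emerald_end \<epsilon>, \<epsilon>)"
      using T(3,4) sides(1)[OF T(1)] sides(1)[OF T(2)] by (auto simp: enters_via_def)
    then show False using neq by simp
  qed
qed

subsection \<open>Inactive nodes\<close>

text \<open>The base lies behind one of the two edges or is the node itself, and then the base edge
  is one of the two.\<close>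

lemma enters_via_exists:
  assumes inc: "incident T (emerald_end \<epsilon>) = {\<epsilon>, \<zeta>}" "\<epsilon> \<noteq> \<zeta>"
    and E: "incident E (emerald_end \<epsilon>) = {\<epsilon>, \<zeta>}"
  shows "enters_via \<zeta> \<epsilon> \<or> enters_via \<epsilon> \<zeta>"
proof -
  have \<zeta>: "emerald_end \<zeta> = emerald_end \<epsilon>" "\<zeta> \<in> T"
    using at_emerald_end[of \<zeta> T \<epsilon>] inc(1) by auto
  have "b \<in> vside \<zeta> \<or> b = emerald_end \<epsilon> \<or> b \<in> vside \<epsilon>"
    using sides(2)[OF \<zeta>(2)] base_node unfolding eside_degree_two(1)[OF inc] by auto
  then show ?thesis
    using inc \<zeta>(1) base E unfolding enters_via_def by (auto simp: insert_commute)
qed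

text \<open>Losing degree forces \<open>T\<close> to use both edges at \<open>x\<close>; the one by
  which the tour does not enter is the candidate \<open>\<epsilon>\<close>. In \<open>T'\<close> the
  violet nodes of its two sides are linked through an emerald node, which must be \<open>x'\<close>,
  and the order decides which edge at \<open>x'\<close> belongs to \<open>T\<close>.\<close>

lemma reversing_if_emerald_inactive:
  assumes "internally_inactive G (emerald_nodes G) (violet_node_less G \<rho> (b, \<beta>) T)
    (hypertree_of T) x"
  shows "\<exists>\<epsilon> \<delta>. reversing \<epsilon> \<delta> \<and> x \<in> endpoints \<epsilon>"
proof -
  obtain x' T' where x: "x \<in> emerald_nodes G" "x' \<in> emerald_nodes G"
    and less: "violet_node_less G \<rho> (b, \<beta>) T x' x"
    and T': "spanning_tree G T'"
    and deg: "\<And>y. y \<in> emerald_nodes G \<Longrightarrow> int (degree T' y) =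
      ((hypertree_of T)(x := hypertree_of T x - 1, x' := hypertree_of T x' + 1)) y + 1"
    using assms unfolding internally_inactive_def hypertree_def by blast
  have T'E: "T' \<subseteq> E" using T' by (simp add: spanning_tree_def)
  have "x' \<noteq> x" using less unfolding violet_node_less_iff by blast
  have degx: "degree T x = Suc (degree T' x)" and degx': "degree T' x' = Suc (degree T x')"
    using deg[OF x(1)] deg[OF x(2)] \<open>x' \<noteq> x\<close> by (auto simp: hypertree_of_def)
  have degy: "degree T' y = degree T y" if "y \<in> emerald_nodes G" "y \<noteq> x" "y \<noteq> x'" for y
    using deg[OF that(1)] that by (simp add: hypertree_of_def)
  have degE: "degree F y \<le> 2" if "F \<subseteq> E" "\<epsilon> \<in> F" "y = emerald_end \<epsilon>" for F y \<epsilon>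
  proof -
    have "\<epsilon> \<in> E" using that by auto
    from other_edge[OF this] that(3) obtain \<zeta> where "incident E y = {\<epsilon>, \<zeta>}" "\<zeta> \<noteq> \<epsilon>"
      by blast
    moreover have "incident F y \<subseteq> incident E y" using that by (auto simp: incident_def)
    ultimately show ?thesis
      unfolding degree_def using card_mono[of "incident E y" "incident F y"] by simp
  qed
  have full: "incident F y = incident E y"
    if "F \<subseteq> E" "degree F y \<ge> 2" "\<epsilon> \<in> E" "y = emerald_end \<epsilon>" for F y \<epsilon>
  proof -
    from other_edge[OF that(3)] that(4) obtain \<zeta> where "incident E y = {\<epsilon>, \<zeta>}" "\<zeta> \<noteq> \<epsilon>"
      by blast
    moreover have "incident F y \<subseteq> incident E y" using that by (auto simp: incident_def)
    ultimately show ?thesis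
      using that(2) by (intro card_seteq) (auto simp: degree_def)
  qed
  have "degree T' x \<ge> 1" using degree_pos[OF T'] x color_nodes by blast
  then have "degree T x \<ge> 2" using degx by simp
  then have "incident T x \<noteq> {}" by (auto simp: degree_def)
  then obtain \<epsilon>\<^sub>1 where \<epsilon>\<^sub>1: "\<epsilon>\<^sub>1 \<in> E" "x = emerald_end \<epsilon>\<^sub>1"
    using x(1) T_subset by (auto simp: incident_def endpoints_def emerald_nodes_def violet_end_def)
  obtain \<epsilon>\<^sub>2 where \<epsilon>\<^sub>2: "incident E x = {\<epsilon>\<^sub>1, \<epsilon>\<^sub>2}" "\<epsilon>\<^sub>2 \<noteq> \<epsilon>\<^sub>1"
    using other_edge[OF \<epsilon>\<^sub>1(1)] \<epsilon>\<^sub>1(2) by blast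
  have incT: "incident T x = {\<epsilon>\<^sub>1, \<epsilon>\<^sub>2}"
    using full[OF T_subset \<open>degree T x \<ge> 2\<close> \<epsilon>\<^sub>1] \<epsilon>\<^sub>2 by simp
  then have "enters_via \<epsilon>\<^sub>1 \<epsilon>\<^sub>2 \<or> enters_via \<epsilon>\<^sub>2 \<epsilon>\<^sub>1"
    using enters_via_exists[of \<epsilon>\<^sub>1 \<epsilon>\<^sub>2] \<epsilon>\<^sub>2 unfolding \<epsilon>\<^sub>1(2) by auto
  moreover have "emerald_end \<epsilon>\<^sub>2 = x"
    using \<epsilon>\<^sub>2(1) at_emerald_end[of \<epsilon>\<^sub>2 E \<epsilon>\<^sub>1] \<epsilon>\<^sub>1(2) by auto
  ultimately obtain \<epsilon> \<zeta> where z: "enters_via \<zeta> \<epsilon>" and xe: "x = emerald_end \<epsilon>"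
    using \<epsilon>\<^sub>1(2) by blast
  have inc: "incident T (emerald_end \<epsilon>) = {\<epsilon>, \<zeta>}" "\<epsilon> \<noteq> \<zeta>" "emerald_end \<zeta> = x"
    using z xe by (auto simp: enters_via_def)
  have \<epsilon>: "\<epsilon> \<in> T" "\<zeta> \<in> T" "b \<in> eside \<epsilon>" using enters_via_tree[OF z] by auto
  have \<epsilon>E: "\<epsilon> \<in> E" "\<zeta> \<in> E" using \<epsilon> T_subset by auto
  have \<zeta>v: "violet_end \<zeta> \<notin> vside \<epsilon>"
    using eside_degree_two(2)[OF inc(1,2)] sides(1)[OF \<epsilon>(1)] reach_refl[of "violet_end \<zeta>"] by blast
  have "\<exists>\<eta>\<^sub>1\<in>T'. \<exists>\<eta>\<^sub>2\<in>T'. emerald_end \<eta>\<^sub>1 = emerald_end \<eta>\<^sub>2 \<and>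
      violet_end \<eta>\<^sub>1 \<in> vside \<epsilon> \<and> violet_end \<eta>\<^sub>2 \<notin> vside \<epsilon>"
  proof (rule ccontr)
    assume none: "\<not> ?thesis"
    \<comment> \<open>The violet nodes of \<open>vside \<epsilon>\<close> with their
      \<open>T'\<close>-neighbours; without a linking emerald node this set is closed under
      \<open>T'\<close> but misses the violet end of \<open>\<zeta>\<close>.\<close>
    let ?U = "{y. is_violet y \<and> y \<in> vside \<epsilon>} \<union> emerald_end ` {\<eta> \<in> T'. violet_end \<eta> \<in> vside \<epsilon>}"
    have "reach T' (violet_end \<epsilon>) \<subseteq> ?U"
    proof (rule reach_subsetI)
      fix \<eta> assume \<eta>: "\<eta> \<in> T'"
      have "emerald_end \<eta> \<in> ?U \<longleftrightarrow> violet_end \<eta> \<in> vside \<epsilon>"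
        using none \<eta> by (auto simp del: split_paired_Ex)
      then show "violet_end \<eta> \<in> ?U \<longleftrightarrow> emerald_end \<eta> \<in> ?U" by auto
    qed simp
    then have "violet_end \<zeta> \<in> ?U"
      using nodes_reach[OF T', of "violet_end \<epsilon>"] \<epsilon>E by auto
    then show False using \<zeta>v by auto
  qed
  then obtain \<eta>\<^sub>1 \<eta>\<^sub>2 where \<eta>: "\<eta>\<^sub>1 \<in> T'" "\<eta>\<^sub>2 \<in> T'" "emerald_end \<eta>\<^sub>1 = emerald_end \<eta>\<^sub>2"
    "violet_end \<eta>\<^sub>1 \<in> vside \<epsilon>" "violet_end \<eta>\<^sub>2 \<notin> vside \<epsilon>" by blast
  define y where "y = emerald_end \<eta>\<^sub>1"
  have \<eta>E: "\<eta>\<^sub>1 \<in> E" "\<eta>\<^sub>2 \<in> E" "\<eta>\<^sub>1 \<noteq> \<eta>\<^sub>2" using \<eta> T'E by auto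
  have yE: "y \<in> emerald_nodes G"
    using color_nodes_endpoints(2)[OF \<eta>E(1)] by (auto simp: y_def)
  have incy: "\<eta>\<^sub>1 \<in> incident T' y" "\<eta>\<^sub>2 \<in> incident T' y" "\<eta>\<^sub>1 \<in> incident E y" "\<eta>\<^sub>2 \<in> incident E y"
    using \<eta> \<eta>E unfolding y_def by (auto simp: at_emerald_end)
  have fin: "finite (incident T' y)"
    using finite_subset[OF T'E finite_E] by (simp add: incident_def)
  have degy2: "degree T' y \<ge> 2"
    using card_mono[OF fin, of "{\<eta>\<^sub>1, \<eta>\<^sub>2}"] incy \<eta>E(3) by (simp add: degree_def)
  have Ey: "incident E y = {\<eta>\<^sub>1, \<eta>\<^sub>2}"
    using other_edge[OF \<eta>E(1)] incy(4) \<eta>E(3) unfolding y_def by auto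
  have "y \<noteq> x"
    using degE[OF T_subset \<epsilon>(1) xe] degx degy2 by auto
  \<comment> \<open>At any other node than \<open>x'\<close> the tree \<open>T\<close> would contain
    both edges as well, and then both violet ends would lie on one side of
    \<open>\<epsilon>\<close>.\<close>
  have "y = x'"
  proof (rule ccontr)
    assume "y \<noteq> x'"
    then have "degree T y \<ge> 2" using degy[OF yE \<open>y \<noteq> x\<close>] degy2 by simp
    then have "incident T y = {\<eta>\<^sub>1, \<eta>\<^sub>2}" using full[OF T_subset _ \<eta>E(1)] Ey by (simp add: y_def)
    then have "\<eta>\<^sub>1 \<in> T" "\<eta>\<^sub>2 \<in> T" by (auto simp: incident_def)
    moreover have "\<eta>\<^sub>1 \<noteq> \<epsilon>" "\<eta>\<^sub>2 \<noteq> \<epsilon>" using \<open>y \<noteq> x\<close> \<eta>(3) xe by (auto simp: y_def)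
    ultimately show False
      using tree_edge_sides[of _ \<epsilon> "violet_end \<epsilon>"] \<eta>(3-5) by metis
  qed
  have "degree T y \<le> 1"
    using degE[OF T'E \<eta>(1) y_def] degx' \<open>y = x'\<close> by simp
  have neq: "\<eta>\<^sub>1 \<noteq> \<epsilon>" "\<eta>\<^sub>2 \<noteq> \<epsilon>" using \<open>y \<noteq> x\<close> \<eta>(3) xe by (auto simp: y_def)
  \<comment> \<open>Otherwise \<open>\<eta>\<^sub>2\<close> is in \<open>T\<close>, and right after
    its violet dart the tour reaches \<open>\<eta>\<^sub>1\<close> at \<open>y\<close>. Since
    \<open>x' < x\<close> puts that dart before \<open>\<zeta>\<close>, the non-edge
    \<open>\<eta>\<^sub>1\<close>, whose violet dart comes after \<open>\<zeta>\<close>, would be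
    cut at its emerald end.\<close>
  have "\<eta>\<^sub>1 \<in> T"
  proof (rule ccontr)
    assume "\<eta>\<^sub>1 \<notin> T"
    have "incident T y \<noteq> {}"
      using degree_pos[OF spanning, of y] yE color_nodes by (auto simp: degree_def)
    then have "\<eta>\<^sub>2 \<in> T" using incident_T_subset[of y] \<open>\<eta>\<^sub>1 \<notin> T\<close> Ey by (auto simp: incident_def)
    have "\<rho> y \<eta>\<^sub>2 = \<eta>\<^sub>1"
    proof -
      have "cyclic_on (\<rho> y) {\<eta>\<^sub>1, \<eta>\<^sub>2}"
        using ribbon Ey subsetD[OF color_nodes(2) yE] unfolding ribbon_structure_def
        by (metis insert_not_empty)
      then have "\<rho> y \<eta>\<^sub>2 \<in> {\<eta>\<^sub>1, \<eta>\<^sub>2}" "orbit (\<rho> y) \<eta>\<^sub>2 = {\<eta>\<^sub>1, \<eta>\<^sub>2}"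
        using cyclic_on_inI[of "\<rho> y" "{\<eta>\<^sub>1, \<eta>\<^sub>2}" \<eta>\<^sub>2] orbit_cyclic_eq3[of "\<rho> y" "{\<eta>\<^sub>1, \<eta>\<^sub>2}" \<eta>\<^sub>2]
        by simp_all
      then show ?thesis
        using orbit_eq_singleton_iff[of "\<rho> y" \<eta>\<^sub>2] \<eta>E(3) by auto
    qed
    then have step: "tour_step \<rho> T (violet_end \<eta>\<^sub>2, \<eta>\<^sub>2) = (y, \<eta>\<^sub>1)"
      using \<open>\<eta>\<^sub>2 \<in> T\<close> \<eta>(3) by (simp add: tour_step_def opposite_def y_def)
    have 1: "vpos \<zeta> < vpos \<eta>\<^sub>1"
      using enters_via_pos(1)[OF z _ \<eta>(4), of \<eta>\<^sub>1] \<eta>E by simp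
    have 2: "vpos \<eta>\<^sub>1 < pos y \<eta>\<^sub>1"
      using cut_at_violet[OF \<eta>E(1) \<open>\<eta>\<^sub>1 \<notin> T\<close>] by (simp add: y_def)
    have "\<zeta> \<in> incident E x" using inc(3) \<epsilon>E(2) by auto
    then have "vpos \<eta>\<^sub>1 < vpos \<zeta> \<or> vpos \<eta>\<^sub>2 < vpos \<zeta>"
      using less Ey \<open>y = x'\<close> unfolding violet_node_less_iff by auto
    then have "vpos \<eta>\<^sub>2 < vpos \<zeta>" using 1 by simp
    then have "pos y \<eta>\<^sub>1 = Suc (vpos \<eta>\<^sub>2)"
      using pos_step[OF _ step, of \<zeta> "violet_end \<zeta>"] \<eta>E \<epsilon>E by simp
    then show False using 1 2 \<open>vpos \<eta>\<^sub>2 < vpos \<zeta>\<close> by simp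
  qed
  then have "emerald_end \<eta>\<^sub>2 \<in> vside \<epsilon>"
    using tree_edge_sides[of \<eta>\<^sub>1 \<epsilon> "violet_end \<epsilon>"] neq \<eta>(3,4) by simp
  moreover have "violet_end \<eta>\<^sub>2 \<in> eside \<epsilon>"
    using \<eta>(5) sides(2)[OF \<epsilon>(1)] ends_in_nodes(1)[OF \<eta>E(2)] by blast
  ultimately have "reversing \<epsilon> \<eta>\<^sub>2" using \<epsilon> \<eta>E by (simp add: reversing_def)
  moreover have "x \<in> endpoints \<epsilon>" using xe by (simp add: endpoints_def)
  ultimately show ?thesis by blast
qed

section \<open>Violet nodes: degree counts on the base side\<close>

lemma sum_violet_degrees:
  assumes "finite F" "finite X" "\<And>x. x \<in> X \<Longrightarrow> is_violet x"
  shows "card {\<eta> \<in> F. violet_end \<eta> \<in> X} = (\<Sum>x\<in>X. degree F x)"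
proof -
  have inc: "\<eta> \<in> incident F x \<longleftrightarrow> \<eta> \<in> F \<and> violet_end \<eta> = x" if "x \<in> X" for x \<eta>
    using assms(3)[OF that] by (auto simp: incident_def endpoints_def)
  have "{\<eta> \<in> F. violet_end \<eta> \<in> X} = (\<Union>x\<in>X. incident F x)"
    using inc by auto
  also have "card \<dots> = (\<Sum>x\<in>X. card (incident F x))"
    using assms inc by (intro card_UN_disjoint) (auto simp: incident_def)
  finally show ?thesis by (simp add: degree_def)
qed

text \<open>If no edge reverses the parent edge \<open>\<epsilon>\<close> of a violet node, then the edges of any spanning tree
  with violet end on the emerald side of \<open>\<epsilon>\<close> stay there, and hence form a forest on that side.
  For \<open>T\<close> they form a spanning tree of it, so no spanning tree has more of them.\<close>

lemma card_emerald_side_le: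
  assumes \<epsilon>: "\<epsilon> \<in> T" "b \<in> eside \<epsilon>" and none: "\<And>\<delta>. \<not> reversing \<epsilon> \<delta>" and T': "spanning_tree G T'"
  shows "card {\<eta> \<in> T'. violet_end \<eta> \<in> eside \<epsilon>} \<le> card {\<eta> \<in> T. violet_end \<eta> \<in> eside \<epsilon>}"
proof -
  let ?K = "eside \<epsilon>"
  let ?A = "\<lambda>F. {\<eta> \<in> F. violet_end \<eta> \<in> ?K}"
  have finK: "finite ?K" using sides(2)[OF \<epsilon>(1)] finite_nodes by (metis finite_Un)
  have T'E: "T' \<subseteq> E" using T' by (simp add: spanning_tree_def)
  \<comment> \<open>An edge leaving \<open>?K\<close> from a violet node would be reversing.\<close>
  have inside: "endpoints \<eta> \<subseteq> ?K" if "\<eta> \<in> ?A E" for \<eta>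
    using that none[of \<eta>] \<epsilon> sides(2)[OF \<epsilon>(1)] ends_in_nodes(2)[of \<eta>]
    unfolding reversing_def endpoints_def by blast
  have card: "card (?A F) + card (reach (?A F) ` ?K) = card ?K" if "forest F" "F \<subseteq> E" for F
    using that finite_E finK inside
    by (intro forest_card) (auto intro: forest_subset finite_subset simp del: split_paired_All)
  have "reach (?A T) x = ?K" if x: "x \<in> ?K" for x
  proof
    show "reach (?A T) x \<subseteq> ?K"
      using x inside T_subset by (intro reach_subsetI) (auto simp: endpoints_def)
    have "?K = reach (T - {\<epsilon>}) x" using reach_eq[OF x] by simp
    \<comment> \<open>Adding the complement of \<open>?K\<close> makes the set closed under the
      edges of \<open>T - {\<epsilon>}\<close> outside \<open>?K\<close> too.\<close>
    also have "\<dots> \<subseteq> reach (?A T) x \<union> - ?K"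
    proof (rule reach_subsetI)
      fix \<eta> assume \<eta>: "\<eta> \<in> T - {\<epsilon>}"
      then have "violet_end \<eta> \<in> ?K \<longleftrightarrow> emerald_end \<eta> \<in> ?K" by (rule violet_in_reach_iff)
      then show "violet_end \<eta> \<in> reach (?A T) x \<union> - ?K \<longleftrightarrow> emerald_end \<eta> \<in> reach (?A T) x \<union> - ?K"
        using \<eta> violet_in_reach_iff[of \<eta> "?A T" x] by auto
    qed simp
    finally show "?K \<subseteq> reach (?A T) x" by blast
  qed
  then have "reach (?A T) ` ?K = {?K}"
    by (auto simp: image_def intro: exI[of _ "emerald_end \<epsilon>"])
  then have "card (?A T) + 1 = card ?K"
    using card[OF T_forest T_subset] by simp
  moreover have "card (reach (?A T') ` ?K) \<ge> 1"
  proof -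
    have "reach (?A T') (emerald_end \<epsilon>) \<in> reach (?A T') ` ?K" by simp
    then have "reach (?A T') ` ?K \<noteq> {}" by blast
    then show ?thesis using finK by (simp add: Suc_le_eq card_gt_0_iff)
  qed
  ultimately show ?thesis
    using card[OF spanning_tree_forest[OF T'] T'E] by simp
qed

text \<open>Take \<open>\<epsilon>\<close> to be the parent edge of \<open>x\<close>. The order
  forces \<open>x'\<close> onto the base side, while \<open>x\<close> is not there, so the exchange
  raises the total violet degree on that side, against the bound valid when no edge reverses
  \<open>\<epsilon>\<close>.\<close>

lemma reversing_if_violet_inactive:
  assumes "internally_inactive G (violet_nodes G) (violet_node_less G \<rho> (b, \<beta>) T)
    (hypertree_of T) x"
  shows "\<exists>\<epsilon> \<delta>. reversing \<epsilon> \<delta> \<and> x \<in> endpoints \<epsilon>"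
proof -
  obtain x' T' where x: "x \<in> violet_nodes G" "x' \<in> violet_nodes G"
    and less: "violet_node_less G \<rho> (b, \<beta>) T x' x"
    and T': "spanning_tree G T'"
    and deg: "\<And>y. y \<in> violet_nodes G \<Longrightarrow> int (degree T' y) =
      ((hypertree_of T)(x := hypertree_of T x - 1, x' := hypertree_of T x' + 1)) y + 1"
    using assms unfolding internally_inactive_def hypertree_def by blast
  have xn: "x \<in> bip_nodes G" and xv: "is_violet x" "is_violet x'"
    using x by (auto simp: bip_nodes_def violet_nodes_def)
  obtain \<eta> where \<eta>: "\<eta> \<in> incident E x'" "\<And>\<delta>. \<delta> \<in> incident E x \<Longrightarrow> vpos \<eta> < vpos \<delta>"
    using less unfolding violet_node_less_iff by blast
  have viol: "violet_end \<delta> = y" if "\<delta> \<in> incident E y" "is_violet y" for \<delta> y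
    using that by (auto simp: incident_def endpoints_def)
  \<comment> \<open>A violet base node owns position 0, so no node is smaller.\<close>
  have "b \<noteq> x"
  proof
    assume "b = x"
    then have "vpos \<beta> = 0" using viol[of \<beta> x] base xv(1) pos_base by simp
    then show False using \<eta>(2)[of \<beta>] base \<open>b = x\<close> by simp
  qed
  moreover have "b \<in> reach T x" using nodes_reach[OF spanning xn] base_node by simp
  ultimately obtain \<epsilon> y where \<epsilon>: "\<epsilon> \<in> T" and xy: "endpoints \<epsilon> = {x, y}" and y: "b \<in> reach (T - {\<epsilon>}) y"
    using parent_edge_exists[of b T x] by blast
  have xe: "violet_end \<epsilon> = x" "emerald_end \<epsilon> = y"
    using xy xv(1) by (auto simp: endpoints_def doubleton_eq_iff)
  have b: "b \<in> eside \<epsilon>" using y xe by simp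
  have \<epsilon>E: "\<epsilon> \<in> E" using \<epsilon> T_subset by auto
  \<comment> \<open>The first dart after the crossing of \<open>\<epsilon>\<close> belongs to
    \<open>x\<close>, so no dart beyond \<open>\<epsilon>\<close> precedes all darts at
    \<open>x\<close>.\<close>
  have "x' \<notin> vside \<epsilon>"
  proof
    assume "x' \<in> vside \<epsilon>"
    then have 1: "pos y \<epsilon> < vpos \<eta>"
      using excursion_from_emerald[OF \<epsilon> b \<eta>(1)] viol[OF \<eta>(1) xv(2)] xe by simp
    have step: "tour_step \<rho> T (y, \<epsilon>) = (x, \<rho> x \<epsilon>)"
      using \<epsilon> xe by (auto simp: tour_step_def opposite_def)
    have "\<epsilon> \<in> incident E x" using \<epsilon>E xe by auto
    then have "\<rho> x permutes incident E x" using ribbon xn by (auto simp: ribbon_structure_def)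
    then have \<rho>: "\<rho> x \<epsilon> \<in> incident E x"
      using \<open>\<epsilon> \<in> incident E x\<close> by (simp add: permutes_in_image)
    have "pos x (\<rho> x \<epsilon>) = Suc (pos y \<epsilon>)"
      using pos_step[OF _ step \<eta>(1)] 1 viol[OF \<eta>(1) xv(2)] \<epsilon>E xe by auto
    then show False
      using \<eta>(2)[OF \<rho>] viol[OF \<rho> xv(1)] 1 by simp
  qed
  have "\<exists>\<delta>. reversing \<epsilon> \<delta>"
  proof (rule ccontr)
    assume "\<nexists>\<delta>. reversing \<epsilon> \<delta>"
    then have le: "card {\<eta> \<in> T'. violet_end \<eta> \<in> eside \<epsilon>} \<le> card {\<eta> \<in> T. violet_end \<eta> \<in> eside \<epsilon>}"
      using card_emerald_side_le[OF \<epsilon> b _ T'] by blast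
    let ?X = "violet_nodes G \<inter> eside \<epsilon>"
    have card: "card {\<eta> \<in> F. violet_end \<eta> \<in> eside \<epsilon>} = (\<Sum>z\<in>?X. degree F z)" if "F \<subseteq> E" for F
    proof -
      have "{\<eta> \<in> F. violet_end \<eta> \<in> eside \<epsilon>} = {\<eta> \<in> F. violet_end \<eta> \<in> ?X}"
        using that color_nodes_endpoints(1) by blast
      also have "card \<dots> = (\<Sum>z\<in>?X. degree F z)"
        using that finite_E finite_nodes finite_subset color_nodes(1)
        by (intro sum_violet_degrees) (auto simp: violet_nodes_def intro: finite_subset)
      finally show ?thesis .
    qed
    \<comment> \<open>The loss of degree at \<open>x\<close> is outside the sum; only the gain at
      \<open>x'\<close> counts.\<close>
    have "x \<notin> ?X" using sides(1)[OF \<epsilon>] reach_refl[of x "T - {\<epsilon>}"] unfolding xe by blast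
    have x'X: "x' \<in> ?X"
      using x(2) \<open>x' \<notin> vside \<epsilon>\<close> sides(2)[OF \<epsilon>] color_nodes(1) by blast
    have finX: "finite ?X"
      using finite_nodes color_nodes(1) by (meson finite_Int finite_subset)
    have deg': "degree T' z = degree T z + (if z = x' then 1 else 0)" if "z \<in> ?X" for z
      using deg[of z] that \<open>x \<notin> ?X\<close> x'X by (auto simp: hypertree_of_def split: if_splits)
    have "(\<Sum>z\<in>?X. degree T' z) = (\<Sum>z\<in>?X. degree T z + (if z = x' then 1 else 0))"
      by (rule sum.cong[OF refl deg'])
    also have "\<dots> = (\<Sum>z\<in>?X. degree T z) + 1"
      using finX x'X unfolding sum.distrib by simp
    finally have "(\<Sum>z\<in>?X. degree T' z) = (\<Sum>z\<in>?X. degree T z) + 1" .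
    moreover have "T' \<subseteq> E" using T' by (simp add: spanning_tree_def)
    ultimately show False using le card[OF T_subset] card[of T'] by simp
  qed
  then show ?thesis using xy by blast
qed

end

theorem theorem8p2:
  fixes G :: "('v, 'e) hypergraph"
    and \<rho> :: "('v, 'e) ribbon"
    and b\<^sub>0 :: "('v, 'e) node"
    and \<beta> :: "('v, 'e) bip_edge"
    and T S :: "('v, 'e) bip_edge set"
    and I\<^sub>V I\<^sub>E :: "('v, 'e) node set"
  assumes "loopless_graph G"
    and "ribbon_structure G \<rho>"
    and "b\<^sub>0 \<in> bip_nodes G" and "\<beta> \<in> incident (bip_edges G) b\<^sub>0"
    and "V_cut_Jaeger_tree G \<rho> (b\<^sub>0, \<beta>) T"
    and "S = {\<epsilon> \<in> T. internally_semi_passive G (violet_less \<rho> (b\<^sub>0, \<beta>) T) T \<epsilon>}"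
    and "I\<^sub>V = {x. internally_inactive G (violet_nodes G)
                  (violet_node_less G \<rho> (b\<^sub>0, \<beta>) T) (hypertree_of T) x}"
    and "I\<^sub>E = {x. internally_inactive G (emerald_nodes G)
                  (violet_node_less G \<rho> (b\<^sub>0, \<beta>) T) (hypertree_of T) x}"
  shows "(\<forall>\<epsilon>\<in>S. violet_end \<epsilon> \<in> I\<^sub>V \<and> emerald_end \<epsilon> \<in> I\<^sub>E) \<and>
         (\<forall>x \<in> I\<^sub>V \<union> I\<^sub>E. \<exists>!\<epsilon>. \<epsilon> \<in> S \<and> x \<in> endpoints \<epsilon>)"
proof -
  interpret jaeger_tree G \<rho> b\<^sub>0 \<beta> T
    using assms by unfold_locales
  have S: "\<epsilon> \<in> S \<longleftrightarrow> (\<exists>\<delta>. reversing \<epsilon> \<delta>)" for \<epsilon>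
    unfolding assms(6) semi_passive_iff by (auto simp: reversing_def)
  have "violet_end \<epsilon> \<in> I\<^sub>V \<and> emerald_end \<epsilon> \<in> I\<^sub>E" if "\<epsilon> \<in> S" for \<epsilon>
    using that violet_inactive_if_reversing emerald_inactive_if_reversing
    unfolding S assms(7,8) by blast
  moreover have "\<exists>!\<epsilon>. \<epsilon> \<in> S \<and> x \<in> endpoints \<epsilon>" if "x \<in> I\<^sub>V \<union> I\<^sub>E" for x
  proof -
    have "\<exists>\<epsilon> \<delta>. reversing \<epsilon> \<delta> \<and> x \<in> endpoints \<epsilon>"
      using that reversing_if_violet_inactive reversing_if_emerald_inactive
      unfolding assms(7,8) by blast
    then show ?thesis using reversing_unique unfolding S by metis
  qed
  ultimately show ?thesis by blast
qed

end
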